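(* Let $G$ be a finitely generated metabelian group. Let $k$ be the minimal torsion-free rank of an abelian group $T$ such that there exists an abelian normal subgroup $A$ of $G$ satisfying $G/A\cong T$. Then the relative Dehn function $\tilde\delta_G$ of $G$ (relative to the variety of metabelian groups) satisfies: (1) $\tilde\delta_G(n)\preccurlyeq n^2$ if $k=0$; (2) $\tilde\delta_G(n)\preccurlyeq 2^{n^{2k}}$ if $k>0$.
   Context: A group is metabelian if its derived subgroup is abelian. The free metabelian group on a finite set $X$ is $M_X=F(X)/F(X)''$. Every finitely generated metabelian group $G$ has a finite relative presentation $\mathcal P=\langle X\mid R\rangle_{\mathcal S_2}$, i.e. $X$ and $R\subset M_X$ are finite and $G\cong M_X/\langle\langle R\rangle\rangle$. For $w\in M_X$ with $w=_G1$, the relative area $\widetilde{\mathrm{Area}}_{\mathcal P}(w)$ is the least $l$ such that $w=\prod_{i=1}^l f_i^{-1}r_if_i$ in $M_X$ with $r_i\in R\cup R^{-1}$, $f_i\in M_X$. The relative Dehn function is $\tilde\delta_{\mathcal P}(n)=\sup\{\widetilde{\mathrm{Area}}_{\mathcal P}(w): w=_G1,\ |w|_{M_X}\le n\}$, where $|\cdot|_{M_X}$ is word length in $M_X$ with respect to $X$. For functions $f,g:\mathbb N\to\mathbb N$ (with $0\notin\mathbb N$), $f\preccurlyeq g$ means there is $C>0$ with $f(n)\le Cg(Cn)+Cn+C$ for all $n$; $f\approx g$ means $f\preccurlyeq g$ and $g\preccurlyeq f$. Up to $\approx$, $\tilde\delta_{\mathcal P}$ does not depend on the finite relative presentation and is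 denoted $\tilde\delta_G$. *)

theory Defs
  imports "HOL-Algebra.FiniteProduct" "HOL-Algebra.Generated_Groups" "HOL-Library.Extended_Nat"
begin

section \<open>Group-theoretic notions\<close>

definition metabelian :: "('a, 'b) monoid_scheme \<Rightarrow> bool" where
  "metabelian G \<longleftrightarrow> group G \<and> comm_group (G\<lparr>carrier := derived G (carrier G)\<rparr>)"

definition finitely_generated_group :: "('a, 'b) monoid_scheme \<Rightarrow> bool" where
  "finitely_generated_group G \<longleftrightarrow>
     group G \<and> (\<exists>S. finite S \<and> S \<subseteq> carrier G \<and> generate G S = carrier G)"

definition normal_closure :: "('a, 'b) monoid_scheme \<Rightarrow> 'a set \<Rightarrow> 'a set" where
  "normal_closure G S =
     generate G {inv\<^bsub>G\<^esub> g \<otimes>\<^bsub>G\<^esub> s \<otimes>\<^bsub>G\<^esub> g | g s. g \<in> carrier G \<and> s \<in> S}"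

definition Z_independent :: "('a, 'b) monoid_scheme \<Rightarrow> 'a set \<Rightarrow> bool" where
  "Z_independent T S \<longleftrightarrow> finite S \<and> S \<subseteq> carrier T \<and>
     (\<forall>c :: 'a \<Rightarrow> int. (\<Otimes>\<^bsub>T\<^esub>s\<in>S. s [^]\<^bsub>T\<^esub> c s) = \<one>\<^bsub>T\<^esub> \<longrightarrow> (\<forall>s\<in>S. c s = 0))"

definition torsion_free_rank :: "('a, 'b) monoid_scheme \<Rightarrow> enat" where
  "torsion_free_rank T = (SUP S \<in> {S. Z_independent T S}. enat (card S))"

text \<open>
  Torsion-free ranks of the abelian groups \<open>T\<close> isomorphic to a quotient of \<open>G\<close> by an abelian normal
  subgroup. Taking \<open>T\<close> over the type \<open>'a set\<close> loses nothing: it contains \<open>G Mod A\<close> itself, and the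
  rank is an isomorphism invariant.
\<close>

definition abelian_quotient_ranks :: "('a, 'b) monoid_scheme \<Rightarrow> enat set" where
  "abelian_quotient_ranks G =
     {torsion_free_rank T | T :: 'a set monoid. comm_group T \<and>
        (\<exists>A. A \<lhd> G \<and> comm_group (G\<lparr>carrier := A\<rparr>) \<and> G Mod A \<cong> T)}"

definition list_prod :: "('a, 'b) monoid_scheme \<Rightarrow> 'a list \<Rightarrow> 'a" where
  "list_prod G xs = foldr (monoid.mult G) xs \<one>\<^bsub>G\<^esub>"

definition word_length :: "('a, 'b) monoid_scheme \<Rightarrow> 'a set \<Rightarrow> 'a \<Rightarrow> nat" where
  "word_length G S g =
     (LEAST n. \<exists>ws. length ws = n \<and> set ws \<subseteq> S \<union> m_inv G ` S \<and> g = list_prod G ws)"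


section \<open>Free groups\<close>

text \<open>
  The letter \<open>(x, True)\<close> stands for the generator \<open>x\<close> and \<open>(x, False)\<close> for its inverse. Elements of
  the free group are the freely reduced words.
\<close>

type_synonym 'x letter = "'x \<times> bool"

definition inv_letter :: "'x letter \<Rightarrow> 'x letter" where
  "inv_letter a = (fst a, \<not> snd a)"

definition reduced :: "'x letter list \<Rightarrow> bool" where
  "reduced w \<longleftrightarrow> successively (\<lambda>a b. b \<noteq> inv_letter a) w"

fun cancel_Cons :: "'x letter \<Rightarrow> 'x letter list \<Rightarrow> 'x letter list" where
  "cancel_Cons a [] = [a]"
| "cancel_Cons a (b # w) = (if b = inv_letter a then w else a # b # w)"

definition reduce :: "'x letter list \<Rightarrow> 'x letter list" where
  "reduce w = foldr cancel_Cons w []"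

definition free_group :: "'x set \<Rightarrow> 'x letter list monoid" where
  "free_group B =
     \<lparr>carrier = {w. set w \<subseteq> B \<times> UNIV \<and> reduced w},
      mult = (\<lambda>u v. reduce (u @ v)),
      one = []\<rparr>"


section \<open>Free metabelian groups, relative presentations and relative Dehn functions\<close>

definition second_derived :: "('a, 'b) monoid_scheme \<Rightarrow> 'a set" where
  "second_derived G = derived G (derived G (carrier G))"

definition free_metabelian :: "'x set \<Rightarrow> 'x letter list set monoid" where
  "free_metabelian B = free_group B Mod second_derived (free_group B)"

definition free_metabelian_gen :: "'x set \<Rightarrow> 'x \<Rightarrow> 'x letter list set" where
  "free_metabelian_gen B x =
     second_derived (free_group B) #>\<^bsub>free_group B\<^esub> [(x, True)]"

definition finite_relative_presentation ::
  "('a, 'b) monoid_scheme \<Rightarrow> 'x set \<Rightarrow> 'x letter list set set \<Rightarrow> bool" where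
  "finite_relative_presentation G B R \<longleftrightarrow>
     finite B \<and> finite R \<and> R \<subseteq> carrier (free_metabelian B) \<and>
     G \<cong> free_metabelian B Mod normal_closure (free_metabelian B) R"

definition relative_area ::
  "'x set \<Rightarrow> 'x letter list set set \<Rightarrow> 'x letter list set \<Rightarrow> nat" where
  "relative_area B R w = (let M = free_metabelian B in
     LEAST l. \<exists>ps. length ps = l \<and> set ps \<subseteq> carrier M \<times> (R \<union> m_inv M ` R) \<and>
       w = list_prod M (map (\<lambda>(f, r). inv\<^bsub>M\<^esub> f \<otimes>\<^bsub>M\<^esub> r \<otimes>\<^bsub>M\<^esub> f) ps))"

text \<open>
  The elements \<open>w\<close> of the free metabelian group that represent the identity of the presented group
  are those of the normal closure of \<open>R\<close>. For finite \<open>B\<close> the supremum is over a finite set; see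
  \<open>finite_relative_areas\<close> below.
\<close>

definition relative_areas :: "'x set \<Rightarrow> 'x letter list set set \<Rightarrow> nat \<Rightarrow> nat set" where
  "relative_areas B R n =
     {relative_area B R w | w. w \<in> normal_closure (free_metabelian B) R \<and>
        word_length (free_metabelian B) (free_metabelian_gen B ` B) w \<le> n}"

definition relative_dehn :: "'x set \<Rightarrow> 'x letter list set set \<Rightarrow> nat \<Rightarrow> nat" where
  "relative_dehn B R n = Sup (relative_areas B R n)"

text \<open>Functions are compared on the positive integers only.\<close>

definition asymp_preceq :: "(nat \<Rightarrow> nat) \<Rightarrow> (nat \<Rightarrow> nat) \<Rightarrow> bool" (infix \<open>\<preceq>\<close> 50) where
  "f \<preceq> g \<longleftrightarrow> (\<exists>C>0. \<forall>n>0. f n \<le> C * g (C * n) + C * n + C)"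


section \<open>Well-definedness\<close>

lemma inv_letter_inv_letter [simp]: "inv_letter (inv_letter a) = a"
  by (simp add: inv_letter_def)

lemma reduced_Nil [simp]: "reduced []"
  by (simp add: reduced_def)

lemma reduced_single [simp]: "reduced [a]"
  by (simp add: reduced_def)

lemma reduced_Cons_Cons [simp]:
  "reduced (a # b # w) \<longleftrightarrow> b \<noteq> inv_letter a \<and> reduced (b # w)"
  by (simp add: reduced_def)

lemma reduced_ConsD: "reduced (a # w) \<Longrightarrow> reduced w"
  by (cases w) auto

lemma cancel_Cons_reduced: "reduced w \<Longrightarrow> reduced (cancel_Cons a w)"
  by (cases w) (auto dest: reduced_ConsD)

lemma cancel_Cons_cancel: "reduced w \<Longrightarrow> cancel_Cons a (cancel_Cons (inv_letter a) w) = w"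
  by (cases w; cases "tl w") auto

lemma set_cancel_Cons: "set (cancel_Cons a w) \<subseteq> insert a (set w)"
  by (cases w) auto

lemma foldr_cancel_reduced: "reduced s \<Longrightarrow> reduced (foldr cancel_Cons u s)"
  by (induction u) (auto intro: cancel_Cons_reduced)

lemma reduced_reduce: "reduced (reduce w)"
  by (simp add: reduce_def foldr_cancel_reduced)

lemma set_reduce: "set (reduce w) \<subseteq> set w"
  unfolding reduce_def
proof (induction w)
  case (Cons a w)
  then show ?case using set_cancel_Cons[of a "foldr cancel_Cons w []"] by auto
qed simp

lemma reduce_reduced: "reduced w \<Longrightarrow> reduce w = w"
proof (induction w)
  case (Cons a w)
  then have "reduce w = w" by (auto dest: reduced_ConsD)
  then show ?case using Cons.prems by (cases w) (auto simp: reduce_def)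
qed (simp add: reduce_def)

lemma foldr_cancel_Cons:
  assumes "reduced s"
  shows "foldr cancel_Cons (cancel_Cons a v) s = cancel_Cons a (foldr cancel_Cons v s)"
proof (cases v)
  case (Cons b t)
  then show ?thesis
    using cancel_Cons_cancel[OF foldr_cancel_reduced[OF assms], of a t] by auto
qed simp

lemma foldr_cancel_reduce:
  "reduced s \<Longrightarrow> foldr cancel_Cons (reduce u) s = foldr cancel_Cons u s"
  by (induction u) (simp_all add: reduce_def foldr_cancel_Cons)

lemma reduce_append: "reduce (u @ v) = foldr cancel_Cons u (reduce v)"
  by (simp add: reduce_def)

lemma reduce_append_left [simp]: "reduce (reduce u @ v) = reduce (u @ v)"
  by (simp add: reduce_append foldr_cancel_reduce reduced_reduce)

lemma reduce_append_right [simp]: "reduce (u @ reduce v) = reduce (u @ v)"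
  by (simp add: reduce_append reduce_reduced reduced_reduce)

lemma reduce_inverse: "reduce (rev (map inv_letter w) @ w) = []"
proof (induction w)
  case (Cons a w)
  have "reduce (rev (map inv_letter (a # w)) @ a # w)
      = reduce (rev (map inv_letter w) @ reduce ([inv_letter a, a] @ w))"
    by simp
  also have "reduce ([inv_letter a, a] @ w) = reduce w"
    using cancel_Cons_cancel[OF reduced_reduce, of "inv_letter a" w]
    by (simp add: reduce_def)
  finally show ?case using Cons by simp
qed (simp add: reduce_def)

lemma free_group_simps:
  "carrier (free_group B) = {w. set w \<subseteq> B \<times> UNIV \<and> reduced w}"
  "monoid.mult (free_group B) u v = reduce (u @ v)"
  "one (free_group B) = []"
  by (simp_all add: free_group_def)

lemma group_free_group: "group (free_group B)"
proof (rule groupI)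
  fix u v assume "u \<in> carrier (free_group B)" "v \<in> carrier (free_group B)"
  then show "u \<otimes>\<^bsub>free_group B\<^esub> v \<in> carrier (free_group B)"
    using set_reduce[of "u @ v"] by (auto simp: free_group_simps reduced_reduce)
next
  fix u assume u: "u \<in> carrier (free_group B)"
  let ?v = "reduce (rev (map inv_letter u))"
  have "set ?v \<subseteq> B \<times> UNIV"
    using u set_reduce[of "rev (map inv_letter u)"]
    by (fastforce simp: free_group_simps inv_letter_def)
  then show "\<exists>v\<in>carrier (free_group B). v \<otimes>\<^bsub>free_group B\<^esub> u = \<one>\<^bsub>free_group B\<^esub>"
    by (intro bexI[of _ ?v]) (auto simp: free_group_simps reduced_reduce reduce_inverse)
qed (auto simp: free_group_simps reduce_reduced)

lemma normal_second_derived: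
  assumes "group G"
  shows "second_derived G \<lhd> G"
proof -
  interpret group G by fact
  show ?thesis
    unfolding second_derived_def by (intro derived_is_normal normal_self)
qed

lemma group_free_metabelian: "group (free_metabelian B)"
  unfolding free_metabelian_def
  by (intro normal.factorgroup_is_group normal_second_derived group_free_group)

lemma list_prod_Nil [simp]: "list_prod G [] = \<one>\<^bsub>G\<^esub>"
  by (simp add: list_prod_def)

lemma list_prod_Cons [simp]: "list_prod G (x # xs) = x \<otimes>\<^bsub>G\<^esub> list_prod G xs"
  by (simp add: list_prod_def)

lemma free_metabelian_word:
  assumes "w \<in> carrier (free_metabelian B)"
  shows "\<exists>ws. set ws \<subseteq> free_metabelian_gen B ` B \<union>
                m_inv (free_metabelian B) ` free_metabelian_gen B ` B \<and>
              w = list_prod (free_metabelian B) ws"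
proof -
  let ?F = "free_group B" and ?M = "free_metabelian B"
  let ?N = "second_derived ?F"
  let ?S = "free_metabelian_gen B ` B \<union> m_inv ?M ` free_metabelian_gen B ` B"
  interpret F: group ?F by (rule group_free_group)
  interpret N: normal ?N ?F by (rule normal_second_derived[OF group_free_group])
  have inv_gen: "inv\<^bsub>?M\<^esub> (free_metabelian_gen B x) = ?N #>\<^bsub>?F\<^esub> [(x, False)]" if "x \<in> B" for x
  proof -
    have F: "[(x, b)] \<in> carrier ?F" for b using that by (simp add: free_group_simps)
    have "inv\<^bsub>?F\<^esub> [(x, True)] = [(x, False)]"
      by (rule F.inv_equality) (use F in \<open>simp_all add: free_group_simps reduce_def inv_letter_def\<close>)
    moreover have "inv\<^bsub>?M\<^esub> (free_metabelian_gen B x) = set_inv\<^bsub>?F\<^esub> (free_metabelian_gen B x)"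
      unfolding free_metabelian_def free_metabelian_gen_def
      by (rule N.inv_FactGroup) (use F in \<open>auto simp: carrier_FactGroup\<close>)
    ultimately show ?thesis
      using N.rcos_inv[OF F] by (simp add: free_metabelian_gen_def)
  qed
  have "\<exists>ws. set ws \<subseteq> ?S \<and> ?N #>\<^bsub>?F\<^esub> u = list_prod ?M ws" if "u \<in> carrier ?F" for u
    using that
  proof (induction u)
    case Nil
    show ?case
      by (rule exI[of _ "[]"])
        (use F.coset_mult_one[OF N.subset] in \<open>simp add: free_metabelian_def free_group_simps\<close>)
  next
    case (Cons a u)
    obtain x b where a: "a = (x, b)" by force
    have x: "x \<in> B" using Cons.prems a by (auto simp: free_group_simps)
    have u: "u \<in> carrier ?F" and au: "[a] \<in> carrier ?F"
      using Cons.prems by (auto simp: free_group_simps dest: reduced_ConsD)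
    obtain ws where ws: "set ws \<subseteq> ?S" "?N #>\<^bsub>?F\<^esub> u = list_prod ?M ws"
      using Cons.IH[OF u] by blast
    have "?N #>\<^bsub>?F\<^esub> [a] \<in> ?S"
      using inv_gen[OF x] x a by (cases b) (auto simp: free_metabelian_gen_def image_iff)
    moreover have "?N #>\<^bsub>?F\<^esub> (a # u) = (?N #>\<^bsub>?F\<^esub> [a]) \<otimes>\<^bsub>?M\<^esub> (?N #>\<^bsub>?F\<^esub> u)"
      using N.rcos_sum[OF au u] Cons.prems
      by (simp add: free_metabelian_def free_group_simps reduce_reduced)
    ultimately show ?case
      using ws by (intro exI[of _ "(?N #>\<^bsub>?F\<^esub> [a]) # ws"]) simp
  qed
  then show ?thesis
    using assms by (auto simp: free_metabelian_def carrier_FactGroup)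
qed

lemma normal_closure_subset:
  assumes "group G" "S \<subseteq> carrier G"
  shows "normal_closure G S \<subseteq> carrier G"
proof -
  interpret group G by fact
  show ?thesis
    unfolding normal_closure_def using assms(2) by (intro generate_incl) auto
qed

lemma finite_relative_areas:
  assumes "finite B" "R \<subseteq> carrier (free_metabelian B)"
  shows "finite (relative_areas B R n)"
proof -
  let ?M = "free_metabelian B"
  let ?S = "free_metabelian_gen B ` B \<union> m_inv ?M ` free_metabelian_gen B ` B"
  let ?D = "{w \<in> normal_closure ?M R. word_length ?M (free_metabelian_gen B ` B) w \<le> n}"
  have "?D \<subseteq> list_prod ?M ` {ws. set ws \<subseteq> ?S \<and> length ws \<le> n}"
  proof
    fix w assume w: "w \<in> ?D"
    let ?P = "\<lambda>l. \<exists>ws. length ws = l \<and> set ws \<subseteq> ?S \<and> w = list_prod ?M ws"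
    have "w \<in> carrier ?M"
      using w normal_closure_subset[OF group_free_metabelian assms(2)] by auto
    then have "\<exists>l. ?P l" using free_metabelian_word[of w B] by blast
    then have "?P (word_length ?M (free_metabelian_gen B ` B) w)"
      unfolding word_length_def by (rule LeastI_ex)
    then show "w \<in> list_prod ?M ` {ws. set ws \<subseteq> ?S \<and> length ws \<le> n}" using w by auto
  qed
  moreover have "finite {ws. set ws \<subseteq> ?S \<and> length ws \<le> n}"
    using assms(1) by (intro finite_lists_length_le) simp
  ultimately have "finite ?D" by (meson finite_imageI finite_subset)
  moreover have "relative_areas B R n = relative_area B R ` ?D"
    by (auto simp: relative_areas_def)
  ultimately show ?thesis by simp
qed

end

(*
  Let M be the free metabelian group, N the normal closure of R, and H the preimage in M of an abelian
  normal subgroup of G with quotient T of torsion-free rank k, so that [H,H] <= N and M' <= H. Lift a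
  maximal independent subset of T to t_1,...,t_k in M; the subgroup that it generates has finite index
  in T, so Schreier rewriting turns a relation w of length n into a product of O(n + D^2) conjugates
  u h u^-1, where h runs over a finite subset of H and u is a word of length at most D = O(n) in the
  letters t_i and their inverses (D = 0 if k = 0).

  For x in H and c in M', conjugation by x and by g in M commute on M', so x and g c g^-1 commute
  modulo N at a cost that does not depend on g. Hence two such conjugates commute at a cost O(D), and
  permuting the letters of u costs O(D^2). A product of m conjugates that cancels as a formal sum of
  pairs (multiset of letters, h) therefore has area O(m^2 D^2).

  The formal sums that represent elements of N form a submodule of a free module of finite rank over
  the integer polynomials in 2k variables. Division by a strong Groebner basis expresses the sum of w
  through finitely many relations, with at most (n + D^2) C^(s (D+1)^(2k)) terms. This is O(n) if
  k = 0, and sorting then gives n^2; if k > 0, it gives 2^(n^(2k)).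
*)
theory Submission
  imports Defs "HOL-Library.Multiset_Order" "HOL-Library.Product_Lexorder"
begin

section \<open>Dickson's lemma\<close>

text \<open>Only the image of \<open>H\<close> in the presented group is abelian, so in
  \<open>M\<close> a formal sum fixes a product of conjugates just up to relators, and every
  rearrangement has a price. That commutators of elements of \<open>H\<close> lie in the normal
  closure gives no control of this price as the conjugating words grow. Control comes from splitting
  a commutator with a long word into conjugates of finitely many fixed commutators: in a metabelian
  group conjugation leaves their commutation cost unchanged, so the price is polynomial in
  \<open>D\<close>. A letter and its inverse are treated as independent variables. This gives honest
  polynomials, with a degree and a monomial order, and it is the origin of the exponent
  \<open>2 * k\<close>; the identity \<open>t t^-1 = 1\<close> merely contributes further elements
  to the submodule. Over the integers a dividing leading monomial is not enough, the coefficient has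
  to divide as well, hence the strong basis. The exponential growth is due to the division alone:
  without letters the number of monomials is a constant and only the quadratic sorting cost
  remains.\<close>

lemma nat_seq_mono_subseq:
  fixes s :: "nat \<Rightarrow> nat"
  shows "\<exists>\<phi> :: nat \<Rightarrow> nat. strict_mono \<phi> \<and> mono (\<lambda>n. s (\<phi> n))"
proof -
  \<comment> \<open>\<open>t n\<close> is the minimum of the tail from \<open>n\<close> on, attained
    at \<open>g n\<close>. Tail minima cannot decrease, so places of this kind chosen one after
    another form a monotone subsequence.\<close>
  define t where "t n = (LEAST m. \<exists>i\<ge>n. s i = m)" for n
  have ex: "\<exists>m i. i \<ge> n \<and> s i = m" for n by blast
  have t: "\<exists>i\<ge>n. s i = t n" for n
    unfolding t_def by (rule LeastI_ex) blast
  have tle: "t n \<le> s i" if "i \<ge> n" for n i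
    unfolding t_def by (rule Least_le) (use that in blast)
  obtain g where g: "\<And>n. g n \<ge> n \<and> s (g n) = t n" using t by metis
  define \<phi> where "\<phi> n = ((\<lambda>m. g (Suc m)) ^^ n) (g 0)" for n
  have S: "\<phi> (Suc n) = g (Suc (\<phi> n))" for n by (simp add: \<phi>_def)
  have "strict_mono \<phi>"
    unfolding strict_mono_Suc_iff S using g Suc_le_eq by blast
  moreover have "s (\<phi> n) \<le> s (\<phi> (Suc n))" for n
  proof (cases n)
    case 0
    have "s (\<phi> 0) = t 0" using g[of 0] by (simp add: \<phi>_def)
    then show ?thesis using tle[of 0] 0 by simp
  next
    case (Suc m)
    have "s (\<phi> n) = t (Suc (\<phi> m))" using g Suc S by simp
    moreover have "Suc (\<phi> m) \<le> \<phi> (Suc n)"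
      using \<open>strict_mono \<phi>\<close> Suc by (metis Suc_leI less_SucI lessI strict_mono_less)
    ultimately show ?thesis using tle by simp
  qed
  ultimately show ?thesis by (auto simp: mono_iff_le_Suc intro!: exI[of _ \<phi>])
qed

text \<open>Coordinates are treated one at a time: a further subsequence keeps the monotonicity
  already achieved.\<close>

lemma dickson_subseq:
  fixes f :: "nat \<Rightarrow> 'j \<Rightarrow> nat"
  assumes "finite J"
  shows "\<exists>\<phi> :: nat \<Rightarrow> nat. strict_mono \<phi> \<and> (\<forall>j\<in>J. mono (\<lambda>n. f (\<phi> n) j))"
  using assms
proof (induction J)
  case empty
  show ?case by (rule exI[of _ id]) (simp add: strict_mono_def)
next
  case (insert x J)
  then obtain \<phi> :: "nat \<Rightarrow> nat" where \<phi>: "strict_mono \<phi>" "\<forall>j\<in>J. mono (\<lambda>n. f (\<phi> n) j)" by blast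
  obtain \<psi> :: "nat \<Rightarrow> nat" where \<psi>: "strict_mono \<psi>" "mono (\<lambda>n. f (\<phi> (\<psi> n)) x)"
    using nat_seq_mono_subseq[of "\<lambda>n. f (\<phi> n) x"] by blast
  have "mono (\<lambda>n. f (\<phi> (\<psi> n)) j)" if "j \<in> J" for j
    using \<phi>(2) that strict_mono_mono[OF \<psi>(1)] by (simp add: mono_def)
  then show ?case
    using \<phi> \<psi> by (intro exI[of _ "\<lambda>n. \<phi> (\<psi> n)"]) (auto simp: strict_mono_def)
qed

section \<open>Submodules of polynomial modules, on the level of words\<close>

text \<open>
  The entry \<open>(u, h, b)\<close> stands for the conjugate of the \<open>h\<close>-th base element (inverted if \<open>b\<close> is
  \<open>False\<close>) by the word \<open>u\<close> in \<open>K\<close> letters. Its key is a monomial in \<open>K\<close> commuting variables times the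
  \<open>h\<close>-th basis vector. The length comes first so that the lexicographic order has finite initial
  segments.
\<close>

type_synonym key = "nat \<times> nat multiset \<times> nat"
type_synonym entry = "nat list \<times> nat \<times> bool"

definition entries :: "nat \<Rightarrow> nat \<Rightarrow> entry set" where
  "entries K s = {(u, h, b). set u \<subseteq> {..<K} \<and> h < s}"

fun key :: "entry \<Rightarrow> key" where
  "key (u, h, b) = (length u, mset u, h)"

fun sign :: "entry \<Rightarrow> int" where
  "sign (u, h, b) = (if b then 1 else -1)"

fun inv_entry :: "entry \<Rightarrow> entry" where
  "inv_entry (u, h, b) = (u, h, \<not> b)"

fun shift_entry :: "nat list \<Rightarrow> entry \<Rightarrow> entry" where
  "shift_entry a (u, h, b) = (a @ u, h, b)"

definition inv_word :: "entry list \<Rightarrow> entry list" where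
  "inv_word ws = rev (map inv_entry ws)"

text \<open>Multiplication by a monomial; in the group it becomes conjugation by the word
  \<open>a\<close>.\<close>

definition shift :: "nat list \<Rightarrow> entry list \<Rightarrow> entry list" where
  "shift a = map (shift_entry a)"

fun shift_key :: "nat multiset \<Rightarrow> key \<Rightarrow> key" where
  "shift_key a (n, m, h) = (n + size a, m + a, h)"

text \<open>The coefficient function of the formal sum of a word, an element of the free module of
  rank \<open>s\<close> over the integer polynomials in \<open>K\<close> variables. Words with equal
  \<open>cnt\<close> differ only by the order of entries, the order of letters inside entries, and
  cancelling pairs.\<close>

definition cnt :: "entry list \<Rightarrow> key \<Rightarrow> int" where
  "cnt ws \<kappa> = (\<Sum>e\<leftarrow>ws. if key e = \<kappa> then sign e else 0)"

definition keys :: "nat \<Rightarrow> nat \<Rightarrow> key set" where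
  "keys K s = {(size m, m, h) | m h. set_mset m \<subseteq> {..<K} \<and> h < s}"

lemma cnt_Nil [simp]: "cnt [] = (\<lambda>_. 0)"
  by (simp add: cnt_def fun_eq_iff)

lemma cnt_Cons: "cnt (e # ws) \<kappa> = (if key e = \<kappa> then sign e else 0) + cnt ws \<kappa>"
  by (simp add: cnt_def)

lemma cnt_append [simp]: "cnt (vs @ ws) \<kappa> = cnt vs \<kappa> + cnt ws \<kappa>"
  by (simp add: cnt_def)

lemma key_inv_entry [simp]: "key (inv_entry e) = key e"
  and sign_inv_entry [simp]: "sign (inv_entry e) = - sign e"
  by (cases e, simp)+

lemma inv_word_Nil [simp]: "inv_word [] = []"
  and inv_word_Cons: "inv_word (e # ws) = inv_word ws @ [inv_entry e]"
  and length_inv_word [simp]: "length (inv_word ws) = length ws"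
  and set_inv_word: "set (inv_word ws) = inv_entry ` set ws"
  by (simp_all add: inv_word_def)

lemma cnt_inv_word [simp]: "cnt (inv_word ws) \<kappa> = - cnt ws \<kappa>"
  by (induction ws) (simp_all add: inv_word_Cons cnt_Cons)

lemma cnt_concat_replicate [simp]: "cnt (concat (replicate q ws)) \<kappa> = int q * cnt ws \<kappa>"
  by (induction q) (simp_all add: algebra_simps)

lemma abs_cnt_le_length: "\<bar>cnt ws \<kappa>\<bar> \<le> int (length ws)"
proof (induction ws)
  case (Cons e ws)
  have "\<bar>sign e\<bar> \<le> 1" by (cases e) simp
  then show ?case using Cons by (auto simp: cnt_Cons)
qed simp

lemma cnt_eq_0: "\<kappa> \<notin> key ` set ws \<Longrightarrow> cnt ws \<kappa> = 0"
  by (induction ws) (auto simp: cnt_Cons)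

lemma key_shift_entry [simp]: "key (shift_entry a e) = shift_key (mset a) (key e)"
  and sign_shift_entry [simp]: "sign (shift_entry a e) = sign e"
  by (cases e, simp)+

lemma inj_shift_key: "inj (shift_key a)"
  by (auto simp: inj_def)

lemma shift_key_strict_mono: "\<kappa> < \<kappa>' \<Longrightarrow> shift_key a \<kappa> < shift_key a \<kappa>'"
  by (cases \<kappa>; cases \<kappa>') (auto simp: less_prod_def)

lemma shift_Nil [simp]: "shift a [] = []"
  and shift_Cons [simp]: "shift a (e # ws) = shift_entry a e # shift a ws"
  and shift_append [simp]: "shift a (vs @ ws) = shift a vs @ shift a ws"
  and length_shift [simp]: "length (shift a ws) = length ws"
  by (simp_all add: shift_def)

lemma inv_word_shift: "inv_word (shift a ws) = shift a (inv_word ws)"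
proof -
  have "inv_entry (shift_entry a e) = shift_entry a (inv_entry e)" for e by (cases e) simp
  then show ?thesis by (simp add: inv_word_def shift_def rev_map)
qed

lemma cnt_shift [simp]: "cnt (shift a ws) (shift_key (mset a) \<kappa>) = cnt ws \<kappa>"
  by (induction ws) (simp_all add: cnt_Cons inj_eq[OF inj_shift_key])

lemma cnt_shift_nonzero:
  assumes "cnt (shift a ws) \<kappa>' \<noteq> 0"
  obtains \<kappa> where "\<kappa>' = shift_key (mset a) \<kappa>" "cnt ws \<kappa> \<noteq> 0"
proof -
  have "\<kappa>' \<in> key ` set (shift a ws)" using assms cnt_eq_0 by blast
  then obtain \<kappa> where "\<kappa>' = shift_key (mset a) \<kappa>" by (auto simp: shift_def)
  then show ?thesis using assms that by simp
qed

lemma entries_closed: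
  "e \<in> entries K s \<Longrightarrow> inv_entry e \<in> entries K s"
  "e \<in> entries K s \<Longrightarrow> set a \<subseteq> {..<K} \<Longrightarrow> shift_entry a e \<in> entries K s"
  "e \<in> entries K s \<Longrightarrow> key e \<in> keys K s"
  by (cases e; force simp: entries_def keys_def)+

text \<open>A monomial of degree at most \<open>D\<close> is given by \<open>K\<close> exponents
  between 0 and \<open>D\<close>. This crude count is the source of \<open>(D + 1) ^ K\<close> in
  all later bounds.\<close>

lemma finite_keys_below: "finite {\<kappa> \<in> keys K s. fst \<kappa> \<le> D}"
  and card_keys_below: "card {\<kappa> \<in> keys K s. fst \<kappa> \<le> D} \<le> s * (D + 1) ^ K"
proof -
  let ?A = "{\<kappa> \<in> keys K s. fst \<kappa> \<le> D}"
  let ?B = "({..<K} \<rightarrow>\<^sub>E {..D}) \<times> {..<s}"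
  let ?g = "\<lambda>\<kappa> :: key. case \<kappa> of (n, m, h) \<Rightarrow> (restrict (count m) {..<K}, h)"
  have inj: "inj_on ?g ?A"
  proof (rule inj_onI)
    fix x y assume x: "x \<in> ?A" and y: "y \<in> ?A" and e: "?g x = ?g y"
    obtain m h m' h' where xy: "x = (size m, m, h)" "y = (size m', m', h')"
      "set_mset m \<subseteq> {..<K}" "set_mset m' \<subseteq> {..<K}"
      using x y by (auto simp: keys_def)
    have "count m i = count m' i" for i
    proof (cases "i < K")
      case True
      then have "restrict (count m) {..<K} i = restrict (count m') {..<K} i" using e xy by simp
      then show ?thesis using True by simp
    next
      case False
      then have "i \<notin># m" "i \<notin># m'" using xy by auto
      then show ?thesis by (simp add: not_in_iff)
    qed
    then have "m = m'" by (simp add: multiset_eq_iff)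
    then show "x = y" using e xy by auto
  qed
  have cle: "count m i \<le> size m" for m :: "nat multiset" and i
    by (rule count_le_size)
  have sub: "?g ` ?A \<subseteq> ?B"
  proof
    fix y assume "y \<in> ?g ` ?A"
    then obtain m h where m: "y = (restrict (count m) {..<K}, h)" "h < s" "size m \<le> D"
      by (auto simp: keys_def)
    then show "y \<in> ?B" using order_trans[OF cle m(3)] by auto
  qed
  have fB: "finite ?B" by (intro finite_cartesian_product finite_PiE) auto
  show "finite ?A" using inj_on_finite[OF inj sub fB] .
  have "card ?A \<le> card ?B" using card_inj_on_le[OF inj sub fB] .
  then show "card ?A \<le> s * (D + 1) ^ K"
    by (simp add: card_cartesian_product card_PiE mult.commute)
qed

text \<open>The closure conditions make the formal sums of \<open>KK\<close> a submodule. The words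
  themselves are kept, since they are later evaluated in a noncommutative group.\<close>

locale shift_closed =
  fixes K s :: nat and KK :: "entry list set"
  assumes valid: "ws \<in> KK \<Longrightarrow> set ws \<subseteq> entries K s"
    and Nil_in: "[] \<in> KK"
    and append_in: "vs \<in> KK \<Longrightarrow> ws \<in> KK \<Longrightarrow> vs @ ws \<in> KK"
    and inv_in: "ws \<in> KK \<Longrightarrow> inv_word ws \<in> KK"
    and shift_in: "ws \<in> KK \<Longrightarrow> set a \<subseteq> {..<K} \<Longrightarrow> shift a ws \<in> KK"
begin

section \<open>Leading terms and strong Groebner bases over the integers\<close>

definition leads :: "entry list \<Rightarrow> key \<Rightarrow> bool" where
  "leads ws \<kappa> \<longleftrightarrow> cnt ws \<kappa> \<noteq> 0 \<and> (\<forall>\<kappa>'>\<kappa>. cnt ws \<kappa>' = 0)"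

lemma leadsD: "leads ws \<kappa> \<Longrightarrow> \<kappa> < \<kappa>' \<Longrightarrow> cnt ws \<kappa>' = 0"
  unfolding leads_def by blast

definition lead_keys :: "key set" where
  "lead_keys = {\<kappa>. \<exists>ws\<in>KK. leads ws \<kappa>}"

text \<open>For a lead key, the leading coefficients at \<open>\<kappa>\<close> together with 0 form
  an ideal of the integers, and this is its positive generator.\<close>

definition lead_coeff :: "key \<Rightarrow> nat" where
  "lead_coeff \<kappa> = (LEAST d. \<exists>ws\<in>KK. leads ws \<kappa> \<and> cnt ws \<kappa> = int d)"

lemma replicate_in: "ws \<in> KK \<Longrightarrow> concat (replicate q ws) \<in> KK"
  by (induction q) (auto intro: Nil_in append_in)

lemma ex_positive_lead:
  assumes "\<kappa> \<in> lead_keys"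
  shows "\<exists>d. \<exists>ws\<in>KK. leads ws \<kappa> \<and> cnt ws \<kappa> = int d"
proof -
  obtain ws where ws: "ws \<in> KK" "leads ws \<kappa>" using assms by (auto simp: lead_keys_def)
  show ?thesis
  proof (cases "cnt ws \<kappa> \<ge> 0")
    case True
    then show ?thesis using ws by (metis nonneg_int_cases)
  next
    case False
    then have "leads (inv_word ws) \<kappa>" "cnt (inv_word ws) \<kappa> \<ge> 0"
      using ws by (auto simp: leads_def)
    then show ?thesis using inv_in[OF ws(1)] by (metis nonneg_int_cases)
  qed
qed

lemma lead_coeff:
  assumes "\<kappa> \<in> lead_keys"
  obtains ws where "ws \<in> KK" "leads ws \<kappa>" "cnt ws \<kappa> = int (lead_coeff \<kappa>)"
  using LeastI_ex[OF ex_positive_lead[OF assms]] unfolding lead_coeff_def by blast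

lemma lead_coeff_le:
  assumes "ws \<in> KK" "leads ws \<kappa>" "cnt ws \<kappa> = int d"
  shows "lead_coeff \<kappa> \<le> d"
  unfolding lead_coeff_def by (rule Least_le) (use assms in blast)

text \<open>Division with remainder: a nonzero remainder would be a leading coefficient at
  \<open>\<kappa>\<close> below the least one.\<close>

lemma lead_coeff_dvd:
  assumes "ws \<in> KK" "leads ws \<kappa>"
  shows "int (lead_coeff \<kappa>) dvd cnt ws \<kappa>"
proof (rule ccontr)
  assume ndvd: "\<not> ?thesis"
  have \<kappa>: "\<kappa> \<in> lead_keys" using assms by (auto simp: lead_keys_def)
  then obtain vs where vs: "vs \<in> KK" "leads vs \<kappa>" "cnt vs \<kappa> = int (lead_coeff \<kappa>)"
    by (rule lead_coeff)
  let ?d = "int (lead_coeff \<kappa>)"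
  have d: "?d > 0" using vs by (auto simp: leads_def)
  define q where "q = cnt ws \<kappa> div ?d"
  define r where "r = cnt ws \<kappa> mod ?d"
  have r: "cnt ws \<kappa> = ?d * q + r" by (simp add: q_def r_def)
  have r0: "0 < r" "r < ?d"
    using d ndvd pos_mod_bound[OF d, of "cnt ws \<kappa>"] pos_mod_sign[OF d, of "cnt ws \<kappa>"]
      mod_0_imp_dvd[of "cnt ws \<kappa>" ?d] unfolding r_def by linarith+
  define us where "us = (if q \<ge> 0 then concat (replicate (nat q) (inv_word vs))
                         else concat (replicate (nat (- q)) vs))"
  have us: "us \<in> KK" using vs(1) by (simp add: us_def replicate_in inv_in)
  have cus: "cnt us \<kappa>' = - q * cnt vs \<kappa>'" for \<kappa>' by (simp add: us_def)
  have "cnt (ws @ us) \<kappa> = int (nat r)" using r r0 vs(3) by (simp add: cus algebra_simps)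
  moreover have "leads (ws @ us) \<kappa>"
    using assms(2) vs(2) calculation r0 by (auto simp: leads_def cus)
  ultimately have "lead_coeff \<kappa> \<le> nat r"
    using lead_coeff_le append_in[OF assms(1) us] by blast
  then show False using r0 by linarith
qed

text \<open>The order on keys is a monomial order, so multiplication by a monomial moves the leading
  term along.\<close>

lemma leads_shift: "leads ws \<kappa> \<Longrightarrow> leads (shift a ws) (shift_key (mset a) \<kappa>)"
  unfolding leads_def
proof (elim conjE, intro conjI allI impI)
  fix \<kappa>' assume a: "\<forall>\<kappa>'>\<kappa>. cnt ws \<kappa>' = 0" and lt: "shift_key (mset a) \<kappa> < \<kappa>'"
  show "cnt (shift a ws) \<kappa>' = 0"
  proof (rule ccontr)
    assume "cnt (shift a ws) \<kappa>' \<noteq> 0"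
    then obtain \<kappa>1 where k: "\<kappa>' = shift_key (mset a) \<kappa>1" "cnt ws \<kappa>1 \<noteq> 0"
      by (rule cnt_shift_nonzero)
    have "\<not> \<kappa> < \<kappa>1" using a k by blast
    then have "\<kappa>1 = \<kappa> \<or> \<kappa>1 < \<kappa>"
      using linorder_less_linear by blast
    then have "\<not> shift_key (mset a) \<kappa> < \<kappa>'"
      using k(1) shift_key_strict_mono[of \<kappa>1 \<kappa> "mset a"] by (elim disjE) (simp_all add: order_less_imp_not_less del: shift_key.simps)
    then show False using lt by simp
  qed
qed simp

lemma ex_list_of_mset:
  assumes "set_mset a \<subseteq> {..<K}"
  obtains l where "mset l = a" "set l \<subseteq> {..<K}"
  using assms ex_mset[of a] by (metis set_mset_mset)

lemma lead_keys_subset: "\<kappa> \<in> lead_keys \<Longrightarrow> \<kappa> \<in> keys K s"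
proof -
  assume "\<kappa> \<in> lead_keys"
  then obtain ws where ws: "ws \<in> KK" "cnt ws \<kappa> \<noteq> 0" by (auto simp: lead_keys_def leads_def)
  then have "\<kappa> \<in> key ` set ws" using cnt_eq_0 by blast
  then show ?thesis using valid[OF ws(1)] entries_closed(3) by blast
qed

lemma lead_coeff_shift_le:
  assumes "\<kappa> \<in> lead_keys" "set_mset a \<subseteq> {..<K}"
  shows "lead_coeff (shift_key a \<kappa>) \<le> lead_coeff \<kappa>"
proof -
  obtain l where l: "mset l = a" "set l \<subseteq> {..<K}" using assms(2) by (rule ex_list_of_mset)
  obtain ws where ws: "ws \<in> KK" "leads ws \<kappa>" "cnt ws \<kappa> = int (lead_coeff \<kappa>)"
    using assms(1) by (rule lead_coeff)
  show ?thesis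
    using lead_coeff_le[OF shift_in[OF ws(1) l(2)] leads_shift[OF ws(2)]] ws(3)
    by (simp flip: l(1))
qed

text \<open>Lead keys whose leading term, coefficient included, is not a proper monomial multiple of
  another one. Witnesses at these keys form a strong Groebner basis.\<close>

definition basic_keys :: "key set" where
  "basic_keys = {\<kappa> \<in> lead_keys. \<forall>\<kappa>0 \<in> lead_keys. \<forall>a. set_mset a \<subseteq> {..<K} \<longrightarrow> a \<noteq> {#} \<longrightarrow>
      \<kappa> = shift_key a \<kappa>0 \<longrightarrow> lead_coeff \<kappa>0 \<noteq> lead_coeff \<kappa>}"

text \<open>Among infinitely many keys Dickson's lemma, with the leading coefficient as one more
  coordinate, finds two such that one is a multiple of the other and its coefficient is not smaller.
  Shifting never enlarges the coefficient, so the two coefficients agree, which a basic key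
  forbids.\<close>

lemma finite_basic_keys: "finite basic_keys"
proof (rule ccontr)
  assume "infinite basic_keys"
  then obtain f :: "nat \<Rightarrow> key" where f: "inj f" "range f \<subseteq> basic_keys"
    using infinite_countable_subset by blast
  text \<open>Since both \<open>h\<close> and \<open>s - h\<close> are coordinates, \<open>h\<close> is constant along a monotone subsequence.\<close>
  define g where "g n j = (case f n of (l, m, h) \<Rightarrow>
      if j < K then count m j else if j = K then lead_coeff (f n)
      else if j = K + 1 then h else s - h)" for n j
  obtain \<phi> :: "nat \<Rightarrow> nat" where \<phi>: "strict_mono \<phi>" "\<forall>j\<in>{..K+2}. mono (\<lambda>n. g (\<phi> n) j)"
    using dickson_subseq[of "{..K+2}" g] by auto
  have gle: "g (\<phi> 0) j \<le> g (\<phi> 1) j" if "j \<le> K + 2" for j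
    using \<phi>(2) that by (auto simp: mono_def)
  have fk: "f n \<in> lead_keys" for n using f(2) by (auto simp: basic_keys_def)
  obtain m h where e0: "f (\<phi> 0) = (size m, m, h)" "set_mset m \<subseteq> {..<K}" "h < s"
    using lead_keys_subset[OF fk] by (force simp: keys_def)
  obtain m' h' where e1: "f (\<phi> 1) = (size m', m', h')" "set_mset m' \<subseteq> {..<K}" "h' < s"
    using lead_keys_subset[OF fk] by (force simp: keys_def)
  have "count m j \<le> count m' j" for j
  proof (cases "j < K")
    case True
    then show ?thesis using gle[of j] e0 e1 by (simp add: g_def)
  next
    case False
    then have "j \<notin># m" using e0 by auto
    then show ?thesis by (simp add: not_in_iff)
  qed
  then have sub: "m \<subseteq># m'" by (simp add: subseteq_mset_def)
  have "h = h'" using gle[of "K+1"] gle[of "K+2"] e0 e1 by (simp add: g_def)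
  define a where "a = m' - m"
  have m': "m' = m + a" using sub by (simp add: a_def)
  have sh: "f (\<phi> 1) = shift_key a (f (\<phi> 0))" using e0 e1 \<open>h = h'\<close> m' by simp
  have aK: "set_mset a \<subseteq> {..<K}" using e1 m' by simp
  have "lead_coeff (f (\<phi> 0)) \<le> lead_coeff (f (\<phi> 1))" using gle[of K] e0 e1 by (simp add: g_def)
  then have eq: "lead_coeff (f (\<phi> 0)) = lead_coeff (f (\<phi> 1))"
    using lead_coeff_shift_le[OF fk aK, of "\<phi> 0"] sh by simp
  have "\<phi> 0 \<noteq> \<phi> 1" using \<phi>(1) by (metis strict_mono_less zero_less_one less_irrefl)
  then have "f (\<phi> 0) \<noteq> f (\<phi> 1)" using f(1) by (auto simp: inj_eq)
  then have "a \<noteq> {#}" using sh e0 by auto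
  have "f (\<phi> 1) \<in> basic_keys" using f(2) by blast
  then have "lead_coeff (f (\<phi> 0)) \<noteq> lead_coeff (f (\<phi> 1))"
    unfolding basic_keys_def using fk[of "\<phi> 0"] aK \<open>a \<noteq> {#}\<close> sh by simp
  then show False using eq by simp
qed

text \<open>Every lead key that is not basic comes from one of smaller degree with the same
  coefficient, so the descent ends at a basic key.\<close>

lemma lead_key_from_basic:
  assumes "\<kappa> \<in> lead_keys"
  shows "\<exists>\<kappa>0\<in>basic_keys. \<exists>a. set_mset a \<subseteq> {..<K} \<and> \<kappa> = shift_key a \<kappa>0 \<and>
           lead_coeff \<kappa>0 = lead_coeff \<kappa>"
  using assms
proof (induction \<kappa> rule: measure_induct_rule[of fst])
  case (less \<kappa>)
  show ?case
  proof (cases "\<kappa> \<in> basic_keys")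
    case True
    moreover have "\<kappa> = shift_key {#} \<kappa>" by (cases \<kappa>) simp
    ultimately show ?thesis
      by (intro bexI[of _ \<kappa>] exI[of _ "{#}"] conjI) simp_all
  next
    case False
    then obtain \<kappa>1 a where 1: "\<kappa>1 \<in> lead_keys" "set_mset a \<subseteq> {..<K}" "a \<noteq> {#}"
      "\<kappa> = shift_key a \<kappa>1" "lead_coeff \<kappa>1 = lead_coeff \<kappa>"
      using less.prems unfolding basic_keys_def by blast
    have "fst \<kappa>1 < fst \<kappa>" using 1 by (cases \<kappa>1) (auto simp: nonempty_has_size)
    from less.IH[OF this 1(1)] obtain \<kappa>0 b where
      "\<kappa>0 \<in> basic_keys" "set_mset b \<subseteq> {..<K}" "\<kappa>1 = shift_key b \<kappa>0" "lead_coeff \<kappa>0 = lead_coeff \<kappa>1"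
      by blast
    moreover have "shift_key a (shift_key b \<kappa>0) = shift_key (b + a) \<kappa>0" by (cases \<kappa>0) (simp add: add.assoc)
    ultimately show ?thesis using 1
      by (intro bexI[of _ \<kappa>0] exI[of _ "b + a"] conjI) simp_all
  qed
qed

text \<open>A polynomial combination of relations, written as a list of monomials times relations.
  In the group it is a product of conjugates of these relations.\<close>

definition spread :: "(nat list \<times> entry list) list \<Rightarrow> entry list" where
  "spread ps = concat (map (\<lambda>(a, V). shift a V) ps)"

lemma spread_append [simp]: "spread (ps @ qs) = spread ps @ spread qs"
  by (simp add: spread_def)

lemma cnt_spread_replicate: "cnt (spread (replicate q (a, V))) \<kappa> = int q * cnt (shift a V) \<kappa>"
  by (simp add: spread_def)

text \<open>Division by a strong Groebner basis over the integers. The coefficients grow by a constant factor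
  for every key that is cleared, whence the exponential in the number of keys.\<close>

theorem bounded_reduction:
  "\<exists>W C. finite W \<and> W \<subseteq> KK \<and> 0 < C \<and>
    (\<forall>ws\<in>KK. \<forall>D. (\<forall>\<kappa>. cnt ws \<kappa> \<noteq> 0 \<longrightarrow> fst \<kappa> \<le> D) \<longrightarrow>
      (\<exists>ps. set ps \<subseteq> {a. set a \<subseteq> {..<K} \<and> length a \<le> D} \<times> W \<and>
        length ps \<le> length ws * C ^ (s * (D + 1) ^ K) \<and> cnt ws = cnt (spread ps)))"
proof -
  have "\<forall>\<kappa>\<in>lead_keys. \<exists>ws. ws \<in> KK \<and> leads ws \<kappa> \<and> cnt ws \<kappa> = int (lead_coeff \<kappa>)"
    using lead_coeff by metis
  then obtain U where U: "\<And>\<kappa>. \<kappa> \<in> lead_keys \<Longrightarrow>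
      U \<kappa> \<in> KK \<and> leads (U \<kappa>) \<kappa> \<and> cnt (U \<kappa>) \<kappa> = int (lead_coeff \<kappa>)" by metis
  have basic: "\<kappa> \<in> lead_keys" if "\<kappa> \<in> basic_keys" for \<kappa>
    using that by (simp add: basic_keys_def)
  \<comment> \<open>With the inverses included, negative multiples need no separate
    treatment.\<close>
  define W where "W = U ` basic_keys \<union> inv_word ` U ` basic_keys"
  have W: "finite W" "W \<subseteq> KK"
    using finite_basic_keys U basic inv_in by (auto simp: W_def)
  obtain c where c: "\<And>V. V \<in> W \<Longrightarrow> length V \<le> c"
    using W(1) by (meson finite_imageI[THEN finite_nat_set_iff_bounded_le[THEN iffD1]] imageI)
  \<comment> \<open>Clearing a key takes at most \<open>m\<close> copies of a relation of length at
    most \<open>c\<close> and leaves coefficients up to \<open>m * (1 + c)\<close>. The total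
    \<open>m + m * (1 + c) * C ^ card A\<close> is at most
    \<open>m * (c + 2) * C ^ card A\<close>.\<close>
  define C where "C = c + 2"
  \<comment> \<open>\<open>A\<close> contains the keys that may still occur and \<open>m\<close>
    bounds their coefficients. The greatest key is cleared first; downward closure keeps the lower
    terms of the subtracted multiple inside \<open>A\<close>.\<close>
  have red: "\<exists>ps. set ps \<subseteq> {a. set a \<subseteq> {..<K} \<and> length a \<le> D} \<times> W \<and>
        length ps \<le> m * C ^ card A \<and> cnt ws = cnt (spread ps)"
    if "finite A" "A \<subseteq> {\<kappa> \<in> keys K s. fst \<kappa> \<le> D}"
      "\<forall>\<kappa>\<in>A. \<forall>\<kappa>'\<in>keys K s. \<kappa>' < \<kappa> \<longrightarrow> \<kappa>' \<in> A"
      "ws \<in> KK" "\<forall>\<kappa>. cnt ws \<kappa> \<noteq> 0 \<longrightarrow> \<kappa> \<in> A" "\<forall>\<kappa>. \<bar>cnt ws \<kappa>\<bar> \<le> int m"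
    for A D m ws
    using that
  proof (induction A arbitrary: ws m rule: finite_linorder_max_induct)
    case empty
    then have "cnt ws \<kappa> = 0" for \<kappa> by blast
    then have "cnt ws = cnt (spread [])" by (intro ext) (simp add: spread_def)
    then show ?case by (intro exI[of _ "[]"]) simp
  next
    case (insert b A)
    have bA: "b \<notin> A" using insert.hyps(2) by blast
    have A2: "A \<subseteq> {\<kappa> \<in> keys K s. fst \<kappa> \<le> D}" using insert.prems(1) by blast
    have A3: "\<forall>\<kappa>\<in>A. \<forall>\<kappa>'\<in>keys K s. \<kappa>' < \<kappa> \<longrightarrow> \<kappa>' \<in> A"
    proof (intro ballI impI)
      fix \<kappa> \<kappa>' assume that: "\<kappa> \<in> A" "\<kappa>' \<in> keys K s" "\<kappa>' < \<kappa>"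
      have "\<kappa>' \<in> insert b A" using insert.prems(2) that by blast
      moreover have "\<kappa>' \<noteq> b" using that insert.hyps(2) order_less_asym by blast
      ultimately show "\<kappa>' \<in> A" by blast
    qed
    have C: "C ^ card (insert b A) = C * C ^ card A" using insert.hyps(1) bA by simp
    have Cge: "1 \<le> C ^ card A" "1 \<le> C" by (simp_all add: C_def)
    show ?case
    proof (cases "cnt ws b = 0")
      case True
      then have "\<forall>\<kappa>. cnt ws \<kappa> \<noteq> 0 \<longrightarrow> \<kappa> \<in> A" using insert.prems(4) by blast
      then obtain ps where ps: "set ps \<subseteq> {a. set a \<subseteq> {..<K} \<and> length a \<le> D} \<times> W"
        "length ps \<le> m * C ^ card A" "cnt ws = cnt (spread ps)"
        using insert.IH[OF A2 A3 insert.prems(3) _ insert.prems(5)] by blast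
      have "m * C ^ card A \<le> m * C ^ card (insert b A)"
        unfolding C using Cge by simp
      then show ?thesis using ps order_trans by blast
    next
      case False
      have lead: "leads ws b"
        using False insert.prems(4) insert.hyps(2) unfolding leads_def
        by (metis insert_iff order_less_asym order_less_irrefl)
      then have bl: "b \<in> lead_keys" using insert.prems(3) by (auto simp: lead_keys_def)
      obtain \<kappa>0 a0 where a0: "\<kappa>0 \<in> basic_keys" "set_mset a0 \<subseteq> {..<K}" "b = shift_key a0 \<kappa>0"
        "lead_coeff \<kappa>0 = lead_coeff b"
        using lead_key_from_basic[OF bl] by blast
      obtain a where a: "mset a = a0" "set a \<subseteq> {..<K}" using a0(2) by (rule ex_list_of_mset)
      let ?V = "U \<kappa>0"
      have V: "?V \<in> KK" "leads ?V \<kappa>0" "cnt ?V \<kappa>0 = int (lead_coeff b)"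
        using U basic a0(1,4) by auto
      have lV: "length ?V \<le> c" using c a0(1) by (auto simp: W_def)
      have sV: "leads (shift a ?V) b" "cnt (shift a ?V) b = int (lead_coeff b)"
        using leads_shift[OF V(2), of a] cnt_shift[of a ?V \<kappa>0] V(3) a(1) a0(3) by auto
      obtain q where q: "cnt ws b = int (lead_coeff b) * q"
        using lead_coeff_dvd[OF insert.prems(3) lead] by blast
      have dpos: "int (lead_coeff b) \<ge> 1" using sV by (auto simp: leads_def)
      have qm: "\<bar>q\<bar> \<le> int m"
      proof -
        have "1 * \<bar>q\<bar> \<le> int (lead_coeff b) * \<bar>q\<bar>" by (rule mult_right_mono) (use dpos in auto)
        also have "\<dots> = \<bar>cnt ws b\<bar>" using q by (simp add: abs_mult)
        finally show ?thesis using spec[OF insert.prems(5), of b] by linarith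
      qed
      define ps0 where "ps0 = (if q \<ge> 0 then replicate (nat q) (a, ?V)
          else replicate (nat (- q)) (a, inv_word ?V))"
      define us where "us = ws @ inv_word (spread ps0)"
      have c0: "cnt (spread ps0) \<kappa> = q * cnt (shift a ?V) \<kappa>" for \<kappa>
        by (simp add: ps0_def cnt_spread_replicate flip: inv_word_shift)
      have cus: "cnt us \<kappa> = cnt ws \<kappa> - q * cnt (shift a ?V) \<kappa>" for \<kappa>
        by (simp add: us_def c0)
      have "shift a ?V \<in> KK" "shift a (inv_word ?V) \<in> KK"
        using shift_in[OF _ a(2)] V(1) inv_in by auto
      then have "spread ps0 \<in> KK"
        by (simp add: ps0_def spread_def replicate_in)
      then have us: "us \<in> KK" unfolding us_def using insert.prems(3) append_in inv_in by blast
      have usA: "\<kappa> \<in> A" if "cnt us \<kappa> \<noteq> 0" for \<kappa>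
      proof -
        have "\<kappa> \<noteq> b" using that by (auto simp: cus sV(2) q)
        have "\<kappa> \<in> key ` set us" using that cnt_eq_0 by blast
        then have "\<kappa> \<in> keys K s" using valid[OF us] entries_closed(3) by blast
        have "cnt us \<kappa>' = 0" if "b < \<kappa>'" for \<kappa>'
          using leadsD[OF lead that] leadsD[OF sV(1) that] by (simp add: cus)
        then have "\<not> b < \<kappa>" using that by blast
        then have "\<kappa> < b" using \<open>\<kappa> \<noteq> b\<close> linorder_less_linear by blast
        then have "\<kappa> \<in> insert b A" using insert.prems(2) \<open>\<kappa> \<in> keys K s\<close> by blast
        then show ?thesis using \<open>\<kappa> \<noteq> b\<close> by blast
      qed
      have usm: "\<bar>cnt us \<kappa>\<bar> \<le> int (m * (1 + c))" for \<kappa>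
      proof -
        have "\<bar>cnt us \<kappa>\<bar> \<le> \<bar>cnt ws \<kappa>\<bar> + \<bar>q\<bar> * \<bar>cnt (shift a ?V) \<kappa>\<bar>"
          unfolding cus by (metis abs_mult abs_triangle_ineq4)
        also have "\<dots> \<le> int m + int m * int c"
          using spec[OF insert.prems(5), of \<kappa>] qm abs_cnt_le_length[of "shift a ?V" \<kappa>] lV
          by (intro add_mono mult_mono) auto
        finally show ?thesis by (simp add: algebra_simps)
      qed
      obtain ps where ps: "set ps \<subseteq> {a. set a \<subseteq> {..<K} \<and> length a \<le> D} \<times> W"
        "length ps \<le> m * (1 + c) * C ^ card A" "cnt us = cnt (spread ps)"
        using insert.IH[OF A2 A3 us] usA usm by blast
      have "fst b \<le> D" using insert.prems(1) by blast
      then have "length a \<le> D" using a0(3) a(1) by (cases \<kappa>0) auto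
      then have "set ps0 \<subseteq> {a. set a \<subseteq> {..<K} \<and> length a \<le> D} \<times> W"
        using a0(1) a(2) by (auto simp: ps0_def W_def)
      moreover have "length (ps0 @ ps) \<le> m * C ^ card (insert b A)"
      proof -
        have "length ps0 \<le> m * 1" using qm by (auto simp: ps0_def)
        also have "\<dots> \<le> m * C ^ card A" using Cge by (intro mult_left_mono) auto
        finally have "length (ps0 @ ps) \<le> m * C ^ card A + m * (1 + c) * C ^ card A"
          using ps(2) by simp
        also have "\<dots> = m * C ^ card (insert b A)" unfolding C by (simp add: C_def algebra_simps)
        finally show ?thesis .
      qed
      moreover have "cnt ws = cnt (spread (ps0 @ ps))"
      proof
        fix \<kappa>
        have "cnt (spread (ps0 @ ps)) \<kappa> = cnt (spread ps0) \<kappa> + cnt us \<kappa>" using ps(3) by simp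
        then show "cnt ws \<kappa> = cnt (spread (ps0 @ ps)) \<kappa>" by (simp add: c0 cus)
      qed
      ultimately show ?thesis using ps(1) by (intro exI[of _ "ps0 @ ps"]) auto
    qed
  qed
  show ?thesis
  proof (intro exI[of _ W] exI[of _ C] conjI W ballI allI impI)
    show "0 < C" by (simp add: C_def)
  next
    fix ws D assume ws: "ws \<in> KK" and D: "\<forall>\<kappa>. cnt ws \<kappa> \<noteq> 0 \<longrightarrow> fst \<kappa> \<le> D"
    let ?A = "{\<kappa> \<in> keys K s. fst \<kappa> \<le> D}"
    have "fst \<kappa>' \<le> fst \<kappa>" if "\<kappa>' < \<kappa>" for \<kappa> \<kappa>' :: key
      using that by (auto simp: less_prod_def)
    then have down: "\<forall>\<kappa>\<in>?A. \<forall>\<kappa>'\<in>keys K s. \<kappa>' < \<kappa> \<longrightarrow> \<kappa>' \<in> ?A"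
      by (blast intro: order_trans)
    have "\<kappa> \<in> ?A" if "cnt ws \<kappa> \<noteq> 0" for \<kappa>
    proof -
      have "\<kappa> \<in> key ` set ws" using that cnt_eq_0 by blast
      then show ?thesis using D that valid[OF ws] entries_closed(3) by blast
    qed
    then obtain ps where ps: "set ps \<subseteq> {a. set a \<subseteq> {..<K} \<and> length a \<le> D} \<times> W"
        "length ps \<le> length ws * C ^ card ?A" "cnt ws = cnt (spread ps)"
      using red[OF finite_keys_below subset_refl down ws, of "length ws"] abs_cnt_le_length by blast
    have "C ^ card ?A \<le> C ^ (s * (D + 1) ^ K)"
      by (rule power_increasing[OF card_keys_below]) (simp add: C_def)
    then have "length ps \<le> length ws * C ^ (s * (D + 1) ^ K)"
      using ps(2) by (meson le_trans mult_le_mono2)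
    then show "\<exists>ps. set ps \<subseteq> {a. set a \<subseteq> {..<K} \<and> length a \<le> D} \<times> W \<and>
        length ps \<le> length ws * C ^ (s * (D + 1) ^ K) \<and> cnt ws = cnt (spread ps)"
      using ps by blast
  qed
qed

end

section \<open>The area metric\<close>

context group
begin

lemma cancel_left [simp]:
  "x \<in> carrier G \<Longrightarrow> y \<in> carrier G \<Longrightarrow> x \<otimes> (inv x \<otimes> y) = y"
  "x \<in> carrier G \<Longrightarrow> y \<in> carrier G \<Longrightarrow> inv x \<otimes> (x \<otimes> y) = y"
  by (simp_all flip: m_assoc)

lemma list_prod_closed [simp]: "set xs \<subseteq> carrier G \<Longrightarrow> list_prod G xs \<in> carrier G"
  by (induction xs) auto

lemma list_prod_append:
  "set xs \<subseteq> carrier G \<Longrightarrow> set ys \<subseteq> carrier G \<Longrightarrow>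
    list_prod G (xs @ ys) = list_prod G xs \<otimes> list_prod G ys"
  by (induction xs) (auto simp: m_assoc)

text \<open>The factors are ordered as in the generators of \<open>derived\<close>.\<close>

definition br :: "'a \<Rightarrow> 'a \<Rightarrow> 'a" where
  "br x y = x \<otimes> y \<otimes> inv x \<otimes> inv y"

lemma br_closed [simp]: "x \<in> carrier G \<Longrightarrow> y \<in> carrier G \<Longrightarrow> br x y \<in> carrier G"
  by (simp add: br_def)

lemma br_in_derived:
  "x \<in> carrier G \<Longrightarrow> y \<in> carrier G \<Longrightarrow> br x y \<in> derived G (carrier G)"
  unfolding derived_def br_def by (rule generate.incl) blast

lemmas group_word_simps = m_assoc inv_mult_group

end

locale relators = group M for M (structure) +
  fixes R
  assumes R_carrier: "R \<subseteq> carrier M"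
begin

text \<open>Because of \<open>skip\<close> the index is only an upper bound for the number of
  relators, so bounds can be added without tracking minima.\<close>

inductive area :: "nat \<Rightarrow> 'a \<Rightarrow> bool" where
  zero: "area 0 \<one>"
| skip: "area l x \<Longrightarrow> area (Suc l) x"
| step: "area l x \<Longrightarrow> f \<in> carrier M \<Longrightarrow> r \<in> R \<union> m_inv M ` R \<Longrightarrow>
    area (Suc l) (inv f \<otimes> r \<otimes> f \<otimes> x)"

lemma R_inv_carrier: "r \<in> R \<union> m_inv M ` R \<Longrightarrow> r \<in> carrier M"
  using R_carrier by auto

lemma area_carrier: "area l x \<Longrightarrow> x \<in> carrier M"
  by (induction rule: area.induct) (auto simp: subsetD[OF R_carrier])

lemma area_mono:
  assumes "area l x" "l \<le> l'"
  shows "area l' x"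
  using assms(2,1) by (induction rule: dec_induct) (auto intro: skip)

lemma area_mult: "area l x \<Longrightarrow> area l' y \<Longrightarrow> area (l + l') (x \<otimes> y)"
proof (induction rule: area.induct)
  case zero
  then show ?case by (simp add: area_carrier)
next
  case (step l x f r)
  have "inv f \<otimes> r \<otimes> f \<otimes> x \<otimes> y = inv f \<otimes> r \<otimes> f \<otimes> (x \<otimes> y)"
    using step.hyps step.prems by (simp add: m_assoc area_carrier R_inv_carrier)
  then show ?case using area.step[OF step.IH[OF step.prems] step.hyps(2,3)] by simp
qed (auto intro: skip)

lemma area_conj: "area l x \<Longrightarrow> g \<in> carrier M \<Longrightarrow> area l (g \<otimes> x \<otimes> inv g)"
proof (induction rule: area.induct)
  case zero
  then show ?case using area.zero by simp
next
  case (step l x f r)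
  have "g \<otimes> (inv f \<otimes> r \<otimes> f \<otimes> x) \<otimes> inv g
      = inv (f \<otimes> inv g) \<otimes> r \<otimes> (f \<otimes> inv g) \<otimes> (g \<otimes> x \<otimes> inv g)"
    using step.hyps step.prems by (simp add: group_word_simps area_carrier R_inv_carrier)
  then show ?case using area.step[OF step.IH[OF step.prems], of "f \<otimes> inv g" r] step by simp
qed (auto intro: skip)

lemma inv_relator: "r \<in> R \<union> m_inv M ` R \<Longrightarrow> inv r \<in> R \<union> m_inv M ` R"
  using R_carrier by (auto simp: subset_iff)

lemma area_relator:
  assumes "f \<in> carrier M" "r \<in> R \<union> m_inv M ` R"
  shows "area 1 (inv f \<otimes> r \<otimes> f)"
  using area.step[OF zero assms] assms R_inv_carrier by simp

lemma area_inv: "area l x \<Longrightarrow> area l (inv x)"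
proof (induction rule: area.induct)
  case zero
  then show ?case using area.zero by simp
next
  case (step l x f r)
  have "inv (inv f \<otimes> r \<otimes> f \<otimes> x) = inv x \<otimes> (inv f \<otimes> inv r \<otimes> f)"
    using step.hyps by (simp add: group_word_simps area_carrier R_inv_carrier)
  then show ?case
    using area_mult[OF step.IH area_relator[OF step.hyps(2) inv_relator[OF step.hyps(3)]]] by simp
qed (auto intro: skip)

lemma area_normal_closure:
  assumes "x \<in> normal_closure M R"
  shows "\<exists>l. area l x"
  using assms unfolding normal_closure_def
proof (induction rule: generate.induct)
  case one
  then show ?case using zero by blast
next
  case (incl h)
  then show ?case using area_relator by blast
next
  case (inv h)
  then show ?case using area_relator area_inv by blast
next
  case (eng h1 h2)
  then show ?case using area_mult by blast
qed

lemma normal_closure_carrier: "normal_closure M R \<subseteq> carrier M"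
  using normal_closure_subset[OF group_axioms R_carrier] .

lemma area_in_normal_closure: "area l x \<Longrightarrow> x \<in> normal_closure M R"
proof (induction rule: area.induct)
  case zero
  then show ?case by (simp add: normal_closure_def generate.one)
next
  case (step l x f r)
  let ?S = "{inv g \<otimes> s \<otimes> g | g s. g \<in> carrier M \<and> s \<in> R}"
  have "inv f \<otimes> r \<otimes> f \<in> generate M ?S"
  proof (cases "r \<in> R")
    case True
    then show ?thesis using step.hyps by (intro generate.incl) blast
  next
    case False
    then obtain r' where r': "r' \<in> R" "r = inv r'" using step.hyps by blast
    then have "inv f \<otimes> r \<otimes> f = inv (inv f \<otimes> r' \<otimes> f)"
      using step.hyps R_carrier by (auto simp: group_word_simps)
    then show ?thesis using r' step.hyps generate.inv[of "inv f \<otimes> r' \<otimes> f" ?S M] by auto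
  qed
  then show ?case using step.IH unfolding normal_closure_def by (rule generate.eng)
qed

lemma in_normal_closure_iff: "x \<in> normal_closure M R \<longleftrightarrow> (\<exists>l. area l x)"
  using area_normal_closure area_in_normal_closure by blast

lemma normal_closure_mult:
  "x \<in> normal_closure M R \<Longrightarrow> y \<in> normal_closure M R \<Longrightarrow> x \<otimes> y \<in> normal_closure M R"
  unfolding in_normal_closure_iff using area_mult by blast

lemma normal_closure_inv: "x \<in> normal_closure M R \<Longrightarrow> inv x \<in> normal_closure M R"
  unfolding in_normal_closure_iff using area_inv by blast

lemma normal_closure_conj:
  "x \<in> normal_closure M R \<Longrightarrow> g \<in> carrier M \<Longrightarrow> g \<otimes> x \<otimes> inv g \<in> normal_closure M R"
  unfolding in_normal_closure_iff using area_conj by blast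

lemma normal_closure_one: "\<one> \<in> normal_closure M R"
  unfolding in_normal_closure_iff using zero by blast

lemma area_list:
  assumes "area l x"
  shows "\<exists>ps. length ps \<le> l \<and> set ps \<subseteq> carrier M \<times> (R \<union> m_inv M ` R) \<and>
      x = list_prod M (map (\<lambda>(f, r). inv f \<otimes> r \<otimes> f) ps)"
  using assms
proof (induction rule: area.induct)
  case zero
  show ?case by (rule exI[of _ "[]"]) simp
next
  case (skip l x)
  then show ?case using le_SucI by blast
next
  case (step l x f r)
  then obtain ps where "length ps \<le> l" "set ps \<subseteq> carrier M \<times> (R \<union> m_inv M ` R)"
      "x = list_prod M (map (\<lambda>(f, r). inv f \<otimes> r \<otimes> f) ps)" by blast
  then show ?case using step.hyps by (intro exI[of _ "(f, r) # ps"]) auto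
qed

text \<open>Supplies the constants that depend on the presentation: \<open>cost\<close> for basic
  commutators, and later one bound for all basis relations.\<close>

lemma uniform_area_bound:
  assumes "finite P" "\<And>p. p \<in> P \<Longrightarrow> f p \<in> normal_closure M R"
  obtains L where "\<And>p. p \<in> P \<Longrightarrow> area L (f p)"
proof -
  have "\<exists>L. \<forall>p\<in>P. area L (f p)" using assms
  proof (induction P)
    case (insert p P)
    then obtain L L' where "\<forall>p\<in>P. area L (f p)" "area L' (f p)"
      using area_normal_closure by (metis insertCI)
    then have "\<forall>q\<in>insert p P. area (L + L') (f q)" by (auto intro: area_mono)
    then show ?case by blast
  qed simp
  then show ?thesis using that by blast
qed

text \<open>The number of relators separating two elements is a bi-invariant metric.\<close>

definition near :: "nat \<Rightarrow> 'a \<Rightarrow> 'a \<Rightarrow> bool" where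
  "near l x y \<longleftrightarrow> x \<in> carrier M \<and> y \<in> carrier M \<and> area l (x \<otimes> inv y)"

lemma near_refl: "x \<in> carrier M \<Longrightarrow> near 0 x x"
  using zero by (simp add: near_def)

lemma near_mono: "near l x y \<Longrightarrow> l \<le> l' \<Longrightarrow> near l' x y"
  using area_mono by (auto simp: near_def)

lemma near_sym: "near l x y \<Longrightarrow> near l y x"
  using area_inv[of l "x \<otimes> inv y"] by (auto simp: near_def group_word_simps)

lemma near_trans [trans]: "near a x y \<Longrightarrow> near b y z \<Longrightarrow> near (a + b) x z"
  using area_mult[of a "x \<otimes> inv y" b "y \<otimes> inv z"] by (auto simp: near_def group_word_simps)

lemma near_left: "near l x y \<Longrightarrow> g \<in> carrier M \<Longrightarrow> near l (g \<otimes> x) (g \<otimes> y)"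
  using area_conj[of l "x \<otimes> inv y" g] by (auto simp: near_def group_word_simps)

lemma near_right: "near l x y \<Longrightarrow> g \<in> carrier M \<Longrightarrow> near l (x \<otimes> g) (y \<otimes> g)"
  by (auto simp: near_def group_word_simps)

lemma near_one: "near l x \<one> \<longleftrightarrow> area l x"
  using area_carrier by (auto simp: near_def)

definition commuting :: "nat \<Rightarrow> 'a \<Rightarrow> 'a \<Rightarrow> bool" where
  "commuting l x y \<longleftrightarrow> near l (x \<otimes> y) (y \<otimes> x)"

lemma commutingD: "commuting l x y \<Longrightarrow> near l (x \<otimes> y) (y \<otimes> x)"
  by (simp add: commuting_def)

lemma commuting_br:
  "x \<in> carrier M \<Longrightarrow> y \<in> carrier M \<Longrightarrow> commuting l x y \<longleftrightarrow> area l (br x y)"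
  by (simp add: commuting_def near_def br_def group_word_simps)

lemma commuting_mono: "commuting l x y \<Longrightarrow> l \<le> l' \<Longrightarrow> commuting l' x y"
  using near_mono by (auto simp: commuting_def)

lemma commuting_sym: "commuting l x y \<Longrightarrow> commuting l y x"
  using near_sym by (auto simp: commuting_def)

lemma commuting_mult:
  assumes "commuting a x y" "commuting b x z" "x \<in> carrier M" "y \<in> carrier M" "z \<in> carrier M"
  shows "commuting (a + b) x (y \<otimes> z)"
proof -
  have "near a (x \<otimes> y \<otimes> z) (y \<otimes> x \<otimes> z)"
    using assms near_right commutingD by blast
  moreover have "near b (y \<otimes> (x \<otimes> z)) (y \<otimes> (z \<otimes> x))"
    using assms near_left commutingD by blast
  ultimately show ?thesis
    using assms near_trans[of a "x \<otimes> y \<otimes> z" "y \<otimes> x \<otimes> z" b "y \<otimes> z \<otimes> x"]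
    by (simp add: commuting_def m_assoc)
qed

lemma commuting_one: "x \<in> carrier M \<Longrightarrow> commuting 0 x \<one>"
  by (simp add: commuting_def near_refl)

lemma commuting_conj:
  assumes "commuting l x y" "x \<in> carrier M" "y \<in> carrier M" "g \<in> carrier M"
  shows "commuting l (g \<otimes> x \<otimes> inv g) (g \<otimes> y \<otimes> inv g)"
  using near_right[OF near_left[OF commutingD[OF assms(1)] assms(4)], of "inv g"] assms
  by (simp add: commuting_def group_word_simps)

lemma commuting_list_prod:
  assumes "x \<in> carrier M" "\<And>y. y \<in> set ys \<Longrightarrow> y \<in> carrier M \<and> commuting l x y"
  shows "commuting (length ys * l) x (list_prod M ys)"
  using assms(2)
proof (induction ys)
  case Nil
  then show ?case using commuting_one assms(1) by simp
next
  case (Cons y ys)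
  then show ?case using commuting_mult[of l x y "length ys * l" "list_prod M ys"] assms(1)
    by (auto simp: subset_iff)
qed

end

section \<open>Sorting products of conjugates\<close>

text \<open>
  \<open>H\<close> is the preimage of an abelian normal subgroup with abelian quotient. The letters \<open>tt j\<close>, with
  inverses \<open>tt (bar j)\<close>, lift a maximal independent set of that quotient, and \<open>hh\<close> enumerates finitely
  many elements of \<open>H\<close>.
\<close>

locale sorting = relators M R for M (structure) and R +
  fixes H and K s :: nat and tt hh :: "nat \<Rightarrow> 'a" and bar :: "nat \<Rightarrow> nat"
  assumes derived_comm: "x \<in> derived M (carrier M) \<Longrightarrow> y \<in> derived M (carrier M) \<Longrightarrow> x \<otimes> y = y \<otimes> x"
    and H_carrier: "H \<subseteq> carrier M"
    and derived_H: "derived M (carrier M) \<subseteq> H"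
    and br_H: "x \<in> H \<Longrightarrow> y \<in> H \<Longrightarrow> br x y \<in> normal_closure M R"
    and tt_closed: "j < K \<Longrightarrow> tt j \<in> carrier M"
    and bar: "j < K \<Longrightarrow> bar j < K" "j < K \<Longrightarrow> bar j \<noteq> j" "j < K \<Longrightarrow> bar (bar j) = j"
    and tt_bar: "j < K \<Longrightarrow> tt (bar j) = inv (tt j)"
    and hh_H: "h < s \<Longrightarrow> hh h \<in> H" "h < s \<Longrightarrow> inv (hh h) \<in> H"
    and br_tt: "i < K \<Longrightarrow> j < K \<Longrightarrow> \<exists>h<s. hh h = br (tt i) (tt j)"
begin

lemma H_closed: "x \<in> H \<Longrightarrow> x \<in> carrier M"
  using H_carrier by blast

definition wval :: "nat list \<Rightarrow> 'a" where
  "wval v = list_prod M (map tt v)"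

definition hval :: "nat \<Rightarrow> bool \<Rightarrow> 'a" where
  "hval h b = (if b then hh h else inv (hh h))"

definition ev :: "entry \<Rightarrow> 'a" where
  "ev e = (case e of (u, h, b) \<Rightarrow> wval u \<otimes> hval h b \<otimes> inv (wval u))"

definition lval :: "entry list \<Rightarrow> 'a" where
  "lval ws = list_prod M (map ev ws)"

lemma wval_Nil [simp]: "wval [] = \<one>"
  and wval_Cons [simp]: "wval (j # v) = tt j \<otimes> wval v"
  by (simp_all add: wval_def)

lemma wval_closed [simp]: "set v \<subseteq> {..<K} \<Longrightarrow> wval v \<in> carrier M"
  by (induction v) (auto simp: tt_closed)

lemma wval_append:
  "set u \<subseteq> {..<K} \<Longrightarrow> set v \<subseteq> {..<K} \<Longrightarrow> wval (u @ v) = wval u \<otimes> wval v"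
  by (induction u) (auto simp: tt_closed m_assoc)

lemma wval_inv:
  "set u \<subseteq> {..<K} \<Longrightarrow> inv (wval u) = wval (map bar (rev u)) \<and> set (map bar (rev u)) \<subseteq> {..<K}"
proof (induction u)
  case (Cons j u)
  then have "set (map bar (rev u)) \<subseteq> {..<K}" "inv (wval u) = wval (map bar (rev u))" by auto
  then show ?case using Cons.prems
    by (auto simp: wval_append tt_bar inv_mult_group tt_closed bar)
qed simp

lemma hval_H: "h < s \<Longrightarrow> hval h b \<in> H"
  using hh_H by (simp add: hval_def)

lemma hval_closed [simp]: "h < s \<Longrightarrow> hval h b \<in> carrier M"
  using hval_H H_closed by blast

lemma hval_not: "h < s \<Longrightarrow> hval h (\<not> b) = inv (hval h b)"
  using hh_H H_closed by (simp add: hval_def)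

lemma ev_closed [simp]: "e \<in> entries K s \<Longrightarrow> ev e \<in> carrier M"
  by (auto simp: entries_def ev_def)

lemma ev_inv_entry: "e \<in> entries K s \<Longrightarrow> ev (inv_entry e) = inv (ev e)"
  by (auto simp: entries_def ev_def hval_not group_word_simps)

lemma ev_shift_entry:
  "e \<in> entries K s \<Longrightarrow> set a \<subseteq> {..<K} \<Longrightarrow>
    ev (shift_entry a e) = wval a \<otimes> ev e \<otimes> inv (wval a)"
  by (auto simp: entries_def ev_def wval_append group_word_simps)

lemma lval_Nil [simp]: "lval [] = \<one>"
  and lval_Cons [simp]: "lval (e # ws) = ev e \<otimes> lval ws"
  by (simp_all add: lval_def)

lemma lval_closed [simp]: "set ws \<subseteq> entries K s \<Longrightarrow> lval ws \<in> carrier M"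
  by (induction ws) auto

lemma lval_append:
  "set vs \<subseteq> entries K s \<Longrightarrow> set ws \<subseteq> entries K s \<Longrightarrow> lval (vs @ ws) = lval vs \<otimes> lval ws"
  by (induction vs) (auto simp: m_assoc)

lemma set_inv_word_entries: "set ws \<subseteq> entries K s \<Longrightarrow> set (inv_word ws) \<subseteq> entries K s"
  using entries_closed(1) by (auto simp: set_inv_word)

lemma lval_inv_word: "set ws \<subseteq> entries K s \<Longrightarrow> lval (inv_word ws) = inv (lval ws)"
proof (induction ws)
  case (Cons e ws)
  then show ?case
    using set_inv_word_entries[of ws] entries_closed(1)[of e]
    by (simp add: inv_word_Cons lval_append ev_inv_entry inv_mult_group)
qed simp

lemma set_shift_entries:
  "set ws \<subseteq> entries K s \<Longrightarrow> set a \<subseteq> {..<K} \<Longrightarrow> set (shift a ws) \<subseteq> entries K s"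
  using entries_closed(2) by (auto simp: shift_def)

lemma lval_shift:
  "set ws \<subseteq> entries K s \<Longrightarrow> set a \<subseteq> {..<K} \<Longrightarrow>
    lval (shift a ws) = wval a \<otimes> lval ws \<otimes> inv (wval a)"
proof (induction ws)
  case (Cons e ws)
  then show ?case using ev_shift_entry[of e a] ev_closed[of e]
    by (simp add: group_word_simps)
qed simp

section \<open>Costs of commuting and of permuting letters\<close>

definition base :: "'a set" where
  "base = {hval h b | h b. h < s}"

lemma finite_base: "finite base"
proof -
  have "base = (\<lambda>(h, b). hval h b) ` ({..<s} \<times> UNIV)" by (auto simp: base_def)
  then show ?thesis by simp
qed

lemma base_H: "x \<in> base \<Longrightarrow> x \<in> H"
  by (auto simp: base_def hval_H)

lemma base_closed: "x \<in> base \<Longrightarrow> x \<in> carrier M"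
  using base_H H_closed by blast

lemma br_tt_derived:
  "j < K \<Longrightarrow> y \<in> carrier M \<Longrightarrow> br (tt j) y \<in> derived M (carrier M)"
  by (intro br_in_derived tt_closed)

text \<open>Only finitely many commutators of elements of \<open>H\<close> occur here, each in the
  normal closure of \<open>R\<close>. All later rearrangements are paid in multiples of their common
  bound.\<close>

lemma ex_commuting_bound:
  "\<exists>C. \<forall>x\<in>base. (\<forall>y\<in>base. commuting C x y) \<and>
     (\<forall>j<K. \<forall>y\<in>base \<union> tt ` {..<K}. commuting C x (br (tt j) y))"
proof -
  let ?Y = "base \<union> (\<lambda>(j, y). br (tt j) y) ` ({..<K} \<times> (base \<union> tt ` {..<K}))"
  have Y: "y \<in> H" if "y \<in> ?Y" for y
    using that base_H base_closed tt_closed br_tt_derived derived_H by auto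
  have fin: "finite (base \<times> ?Y)" using finite_base by auto
  have "(case p of (x, y) \<Rightarrow> br x y) \<in> normal_closure M R" if "p \<in> base \<times> ?Y" for p
  proof -
    obtain x y where p: "p = (x, y)" by force
    then have "x \<in> base" "y \<in> ?Y" using that by blast+
    then show ?thesis using br_H[OF base_H Y] p by simp
  qed
  then obtain C where C: "\<And>p. p \<in> base \<times> ?Y \<Longrightarrow> area C (case p of (x, y) \<Rightarrow> br x y)"
    using uniform_area_bound[OF fin, of "\<lambda>(x, y). br x y"] by blast
  have "commuting C x y" if "x \<in> base" "y \<in> ?Y" for x y
    using C[of "(x, y)"] that base_closed Y[of y] H_closed commuting_br by auto
  then show ?thesis by (intro exI[of _ C]) auto
qed

definition cost :: nat where
  "cost = (SOME C. \<forall>x\<in>base. (\<forall>y\<in>base. commuting C x y) \<and>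
     (\<forall>j<K. \<forall>y\<in>base \<union> tt ` {..<K}. commuting C x (br (tt j) y)))"

lemma cost:
  "x \<in> base \<Longrightarrow> y \<in> base \<Longrightarrow> commuting cost x y"
  "x \<in> base \<Longrightarrow> j < K \<Longrightarrow> y \<in> base \<union> tt ` {..<K} \<Longrightarrow> commuting cost x (br (tt j) y)"
  using someI_ex[OF ex_commuting_bound] unfolding cost_def by blast+

text \<open>Conjugating an element of the derived subgroup by \<open>x\<close> and by \<open>g\<close> can be done in either order,
  so every conjugate of it commutes with \<open>x\<close> at the same cost.\<close>

definition central :: "nat \<Rightarrow> 'a \<Rightarrow> bool" where
  "central l c \<longleftrightarrow> c \<in> carrier M \<and>
     (\<forall>x\<in>base. \<forall>g\<in>carrier M. commuting l x (g \<otimes> c \<otimes> inv g))"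

lemma derived_carrier: "c \<in> derived M (carrier M) \<Longrightarrow> c \<in> carrier M"
  using derived_H H_closed by blast

lemma central_derived:
  assumes c: "c \<in> derived M (carrier M)" and l: "\<And>x. x \<in> base \<Longrightarrow> commuting l x c"
  shows "central l c"
  unfolding central_def
proof (intro conjI ballI)
  show cc: "c \<in> carrier M" using c derived_carrier by blast
  fix x g assume x: "x \<in> base" and g: "g \<in> carrier M"
  note xc = base_closed[OF x]
  \<comment> \<open>The conjugators \<open>x \<otimes> g\<close> and \<open>g \<otimes> x\<close>
    differ by a factor from the derived subgroup, which commutes with \<open>c\<close>. Hence the
    commutator of \<open>x\<close> with a conjugate of \<open>c\<close> is itself a conjugate of
    \<open>br x c\<close>.\<close>
  have "inv (g \<otimes> x) \<otimes> (x \<otimes> g) = br (inv x) (inv g)"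
    using xc g by (simp add: br_def group_word_simps)
  then have d: "inv (g \<otimes> x) \<otimes> (x \<otimes> g) \<in> derived M (carrier M)"
    using br_in_derived xc g by simp
  have "x \<otimes> (g \<otimes> c \<otimes> inv g) \<otimes> inv x
      = (g \<otimes> x) \<otimes> ((inv (g \<otimes> x) \<otimes> (x \<otimes> g)) \<otimes> c) \<otimes> inv (x \<otimes> g)"
    using xc g cc by (simp add: group_word_simps)
  also have "\<dots> = (g \<otimes> x) \<otimes> (c \<otimes> (inv (g \<otimes> x) \<otimes> (x \<otimes> g))) \<otimes> inv (x \<otimes> g)"
    using derived_comm[OF d c] by simp
  also have "\<dots> = g \<otimes> (x \<otimes> c \<otimes> inv x) \<otimes> inv g"
    using xc g cc by (simp add: group_word_simps)
  finally have "br x (g \<otimes> c \<otimes> inv g) = g \<otimes> br x c \<otimes> inv g"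
    using xc g cc by (simp add: br_def group_word_simps)
  then show "commuting l x (g \<otimes> c \<otimes> inv g)"
    using l[OF x] area_conj[of l "br x c" g] xc g cc by (simp add: commuting_br)
qed

lemma central_mult:
  assumes "central a c" "central b d"
  shows "central (a + b) (c \<otimes> d)"
  unfolding central_def
proof (intro conjI ballI)
  have cd: "c \<in> carrier M" "d \<in> carrier M" using assms by (auto simp: central_def)
  then show "c \<otimes> d \<in> carrier M" by simp
  fix x g assume x: "x \<in> base" and g: "g \<in> carrier M"
  have "g \<otimes> (c \<otimes> d) \<otimes> inv g = (g \<otimes> c \<otimes> inv g) \<otimes> (g \<otimes> d \<otimes> inv g)"
    using cd g by (simp add: group_word_simps)
  then show "commuting (a + b) x (g \<otimes> (c \<otimes> d) \<otimes> inv g)"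
    using assms x g cd base_closed[OF x] commuting_mult[of a x "g \<otimes> c \<otimes> inv g" b]
    by (simp add: central_def)
qed

lemma central_conj:
  assumes "central l c" "g \<in> carrier M"
  shows "central l (g \<otimes> c \<otimes> inv g)"
  unfolding central_def
proof (intro conjI ballI)
  have c: "c \<in> carrier M" using assms by (simp add: central_def)
  then show "g \<otimes> c \<otimes> inv g \<in> carrier M" using assms by simp
  fix x f assume x: "x \<in> base" and f: "f \<in> carrier M"
  have "f \<otimes> (g \<otimes> c \<otimes> inv g) \<otimes> inv f = (f \<otimes> g) \<otimes> c \<otimes> inv (f \<otimes> g)"
    using f c assms(2) by (simp add: group_word_simps)
  then show "commuting l x (f \<otimes> (g \<otimes> c \<otimes> inv g) \<otimes> inv f)"
    using assms x f m_closed[OF f assms(2)] by (simp add: central_def)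
qed

lemma central_one: "central 0 \<one>"
  using base_closed commuting_one by (simp add: central_def)

text \<open>Peeling off the first letter writes the commutator as a conjugate of the commutator with
  the shorter word, times one basic commutator. Conjugation costs nothing for
  \<open>central\<close>, so the total is linear in the length.\<close>

lemma central_br_wval:
  assumes "set v \<subseteq> {..<K}" "y \<in> base \<union> tt ` {..<K}"
  shows "central (length v * cost) (br (wval v) y)"
  using assms(1)
proof (induction v)
  case Nil
  have "br \<one> y = \<one>" using assms(2) base_closed tt_closed by (auto simp: br_def)
  then show ?case using central_one by simp
next
  case (Cons j v)
  have y: "y \<in> carrier M" using assms(2) base_closed tt_closed by auto
  have j: "j < K" "tt j \<in> carrier M" and v: "set v \<subseteq> {..<K}" using Cons.prems tt_closed by auto
  have "br (wval (j # v)) y = (tt j \<otimes> br (wval v) y \<otimes> inv (tt j)) \<otimes> br (tt j) y"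
    using y j wval_closed[OF v] by (simp add: br_def group_word_simps)
  moreover have "central cost (br (tt j) y)"
    using br_tt_derived[OF j(1) y] cost(2)[OF _ j(1) assms(2)] by (rule central_derived)
  ultimately show ?case
    using central_mult[OF central_conj[OF Cons.IH[OF v] j(2)]] by (simp add: add.commute)
qed

text \<open>Conjugation by the inverse of the first word reduces this to \<open>x\<close> against
  \<open>v y v^-1\<close>, where \<open>v\<close> has length at most \<open>2 * D\<close>. The
  latter equals \<open>br v y\<close> times \<open>y\<close>: the commutator costs
  \<open>2 * D\<close> units and \<open>y\<close> one more.\<close>

lemma commuting_ev:
  assumes "e \<in> entries K s" "e' \<in> entries K s" "length (fst e) \<le> D" "length (fst e') \<le> D"
  shows "commuting ((2 * D + 1) * cost) (ev e) (ev e')"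
proof -
  obtain u h b where e: "e = (u, h, b)" by (cases e)
  obtain u' h' b' where e': "e' = (u', h', b')" by (cases e')
  have u: "set u \<subseteq> {..<K}" "set u' \<subseteq> {..<K}" and h: "h < s" "h' < s"
    using assms by (auto simp: e e' entries_def)
  let ?x = "hval h b" and ?y = "hval h' b'"
  have xy: "?x \<in> base" "?y \<in> base" using h by (auto simp: base_def)
  define v where "v = map bar (rev u) @ u'"
  have v: "set v \<subseteq> {..<K}" and wv: "wval v = inv (wval u) \<otimes> wval u'"
    using u wval_inv[OF u(1)] by (auto simp: v_def wval_append)
  have lv: "length v \<le> 2 * D" using assms(3,4) by (simp add: v_def e e')
  have "commuting (length v * cost) ?x (\<one> \<otimes> br (wval v) ?y \<otimes> inv \<one>)"
    using central_br_wval[OF v, of ?y] xy unfolding central_def by blast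
  then have "commuting (length v * cost) ?x (br (wval v) ?y)" using v h by simp
  then have "commuting (length v * cost + cost) ?x (br (wval v) ?y \<otimes> ?y)"
    using cost(1)[OF xy] v h by (intro commuting_mult) auto
  moreover have "length v * cost + cost \<le> (2 * D + 1) * cost" using lv by simp
  ultimately have "commuting ((2 * D + 1) * cost) ?x (br (wval v) ?y \<otimes> ?y)"
    using commuting_mono by blast
  moreover have "br (wval v) ?y \<otimes> ?y = wval v \<otimes> ?y \<otimes> inv (wval v)"
    using v h by (simp add: br_def group_word_simps)
  ultimately have c: "commuting ((2 * D + 1) * cost) ?x (wval v \<otimes> ?y \<otimes> inv (wval v))" by simp
  have "wval u \<otimes> (wval v \<otimes> ?y \<otimes> inv (wval v)) \<otimes> inv (wval u) = ev e'"
    using u h by (simp add: wv e' ev_def group_word_simps)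
  moreover have "wval u \<otimes> ?x \<otimes> inv (wval u) = ev e" by (simp add: e ev_def)
  ultimately show ?thesis using commuting_conj[OF c, of "wval u"] u v h by simp
qed

lemma near_conj_central:
  assumes "central l c" "x \<in> base" "w \<in> carrier M"
  shows "near l (c \<otimes> w \<otimes> x \<otimes> inv (c \<otimes> w)) (w \<otimes> x \<otimes> inv w)"
proof -
  have c: "c \<in> carrier M" using assms(1) by (simp add: central_def)
  note x = base_closed[OF assms(2)]
  let ?c = "inv w \<otimes> c \<otimes> inv (inv w)"
  have "commuting l ?c x" using assms commuting_sym unfolding central_def by blast
  then have "near l (w \<otimes> (?c \<otimes> x) \<otimes> (inv ?c \<otimes> inv w)) (w \<otimes> (x \<otimes> ?c) \<otimes> (inv ?c \<otimes> inv w))"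
    using near_right[OF near_left[OF commutingD]] c x assms(3) by simp
  moreover have "w \<otimes> (?c \<otimes> x) \<otimes> (inv ?c \<otimes> inv w) = c \<otimes> w \<otimes> x \<otimes> inv (c \<otimes> w)"
    using c x assms(3) by (simp add: group_word_simps)
  moreover have "w \<otimes> (x \<otimes> ?c) \<otimes> (inv ?c \<otimes> inv w) = w \<otimes> x \<otimes> inv w"
    using c x assms(3) by (simp add: group_word_simps)
  ultimately show ?thesis by simp
qed

text \<open>The first letter of \<open>u\<close> is brought to the front of \<open>u'\<close>.
  Passing the prefix \<open>a\<close> introduces the factor \<open>br (wval a) (tt j)\<close> in the
  conjugator, removed at cost \<open>length a * cost\<close>; over all letters this is
  quadratic.\<close>

lemma near_ev_permuted:
  assumes "set u \<subseteq> {..<K}" "mset u = mset u'" "h < s"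
  shows "near (length u * length u * cost) (ev (u, h, b)) (ev (u', h, b))"
  using assms(1,2)
proof (induction u arbitrary: u')
  case Nil
  then show ?case using near_refl ev_closed assms(3) by (simp add: entries_def)
next
  case (Cons j v)
  have j: "j < K" "tt j \<in> carrier M" and v: "set v \<subseteq> {..<K}" using Cons.prems tt_closed by auto
  have "j \<in> set u'" using Cons.prems(2) by (metis list.set_intros(1) set_mset_mset)
  then obtain a c where u': "u' = a @ j # c" by (meson split_list)
  have m: "mset v = mset (a @ c)" using Cons.prems(2) u' by simp
  have "set u' = set (j # v)" using Cons.prems(2) by (metis set_mset_mset)
  then have ac: "set a \<subseteq> {..<K}" "set c \<subseteq> {..<K}" using Cons.prems(1) u' by auto
  let ?x = "hval h b"
  have x: "?x \<in> base" "?x \<in> carrier M" using assms(3) by (auto simp: base_def)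
  let ?w = "wval (j # a @ c)"
  have wc: "?w \<in> carrier M" using j ac by (intro wval_closed) auto
  have wu: "wval u' = br (wval a) (tt j) \<otimes> ?w"
    using j ac by (simp add: u' wval_append br_def group_word_simps)
  have "near (length a * cost) (ev (u', h, b)) (ev (j # a @ c, h, b))"
    using near_conj_central[OF central_br_wval[OF ac(1)] x(1) wc, of "tt j"] j(1) wu
    by (simp add: ev_def)
  then have n1: "near (length a * cost) (ev (j # a @ c, h, b)) (ev (u', h, b))"
    by (rule near_sym)
  have ev_j: "ev (j # w, h, b) = tt j \<otimes> ev (w, h, b) \<otimes> inv (tt j)" if "set w \<subseteq> {..<K}" for w
    using that j x by (simp add: ev_def group_word_simps)
  have "near (length v * length v * cost) (ev (v, h, b)) (ev (a @ c, h, b))"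
    using Cons.IH[OF v m] .
  then have "near (length v * length v * cost) (ev (j # v, h, b)) (ev (j # a @ c, h, b))"
    using near_right[OF near_left] ev_j v ac j by simp
  then have "near (length v * length v * cost + length a * cost) (ev (j # v, h, b)) (ev (u', h, b))"
    using n1 near_trans by blast
  moreover have "length v = length a + length c" using mset_eq_length[OF m] by simp
  then have "length v * length v * cost + length a * cost
      \<le> length (j # v) * length (j # v) * cost"
    by (simp add: algebra_simps)
  ultimately show ?case using near_mono by blast
qed

text \<open>In a balanced word the first entry has a partner with the same key and the opposite
  sign. It is moved next to the partner, the letters are permuted until the two cancel, and the word
  is shorter by two.\<close>

lemma area_of_balanced_entries:
  assumes ws: "set ws \<subseteq> entries K s" and c: "cnt ws = (\<lambda>_. 0)"
    and D: "\<And>e. e \<in> set ws \<Longrightarrow> length (fst e) \<le> D"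
  shows "area (length ws * ((length ws + 2) * (2 * D + 1) * (D + 1) * cost)) (lval ws)"
  using assms
proof (induction "length ws" arbitrary: ws rule: less_induct)
  case less
  show ?case
  proof (cases ws)
    case Nil
    then show ?thesis using zero by simp
  next
    case (Cons e vs)
    have "cnt ws (key e) = 0" using less.prems(2) by simp
    then have "cnt vs (key e) = - sign e" using Cons by (simp add: cnt_Cons)
    have "\<exists>e'\<in>set vs. key e' = key e \<and> sign e' = - sign e"
    proof (rule ccontr)
      assume neg: "\<not> ?thesis"
      have sg: "sign x = 1 \<or> sign x = -1" for x by (cases x) simp
      \<comment> \<open>Without a partner all entries at this key would have the sign of
        \<open>e\<close>, and their sum could not be \<open>- sign e\<close>.\<close>
      have "sign e * cnt xs (key e) \<ge> 0" if "set xs \<subseteq> set vs" for xs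
        using that
      proof (induction xs)
        case (Cons x xs)
        have "key x = key e \<Longrightarrow> sign e * sign x \<ge> 0"
          using neg Cons.prems sg[of x] sg[of e] by fastforce
        then show ?case using Cons by (simp add: cnt_Cons distrib_left)
      qed simp
      from this[of vs] show False
        using \<open>cnt vs (key e) = - sign e\<close> sg[of e] by auto
    qed
    then obtain e' A B where e': "vs = A @ e' # B" "key e' = key e" "sign e' = - sign e"
      by (meson split_list)
    obtain u h b where e: "e = (u, h, b)" by (cases e)
    obtain u' where u': "e' = (u', h, \<not> b)" "mset u' = mset u"
      using e' e by (cases e') (auto split: if_splits)
    have ent: "set A \<subseteq> entries K s" "set B \<subseteq> entries K s" "e \<in> entries K s" "e' \<in> entries K s"
      using less.prems(1) Cons e' by auto
    have h: "h < s" and u: "set u \<subseteq> {..<K}" using ent e by (auto simp: entries_def)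
    let ?a = "(2 * D + 1) * cost"
    have "ev x \<in> carrier M \<and> commuting ?a (ev e) (ev x)" if "x \<in> set A" for x
    proof -
      have "x \<in> entries K s" "length (fst x) \<le> D" "length (fst e) \<le> D"
        using that ent less.prems(3) Cons e' by auto
      then show ?thesis using commuting_ev[of e x D] ent by simp
    qed
    then have "commuting (length (map ev A) * ?a) (ev e) (list_prod M (map ev A))"
      using ent by (intro commuting_list_prod) auto
    then have "near (length A * ?a) (ev e \<otimes> lval A) (lval A \<otimes> ev e)"
      by (simp add: commuting_def lval_def)
    then have n1: "near (length A * ?a) (ev e \<otimes> lval A \<otimes> (ev e' \<otimes> lval B))
        (lval A \<otimes> ev e \<otimes> (ev e' \<otimes> lval B))"
      using near_right ent by simp
    have lu: "length u \<le> D" using less.prems(3)[of e] Cons e by simp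
    have "ev e' = inv (ev (u', h, b))"
      using ev_inv_entry[of "(u', h, b)"] ent(4) u' by (auto simp: entries_def)
    moreover have ue: "(u', h, b) \<in> entries K s" using ent(4) u' by (auto simp: entries_def)
    moreover have "near (length u * length u * cost) (ev e) (ev (u', h, b))"
      using near_ev_permuted[OF u _ h] u' e by simp
    ultimately have n: "near (length u * length u * cost) (ev e \<otimes> ev e') \<one>"
      using near_right[of _ "ev e" "ev (u', h, b)" "inv (ev (u', h, b))"] by simp
    have n2: "near (length u * length u * cost)
        (lval A \<otimes> ((ev e \<otimes> ev e') \<otimes> lval B)) (lval A \<otimes> (\<one> \<otimes> lval B))"
      using near_left[OF near_right[OF n lval_closed[OF ent(2)]] lval_closed[OF ent(1)]] .
    have "length A + length B < length ws" using Cons e' by simp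
    moreover have "cnt (A @ B) = (\<lambda>_. 0)"
    proof
      fix \<kappa>
      have "cnt ws \<kappa> = 0" using less.prems(2) by simp
      then show "cnt (A @ B) \<kappa> = 0" using e' Cons by (auto simp: cnt_Cons split: if_splits)
    qed
    ultimately have "area (length (A @ B) * ((length (A @ B) + 2) * (2 * D + 1) * (D + 1) * cost))
        (lval (A @ B))"
      using less.hyps[of "A @ B"] ent less.prems(3) Cons e' by simp
    moreover have lv: "lval (A @ B) = lval A \<otimes> (\<one> \<otimes> lval B)"
      using ent by (simp add: lval_append)
    ultimately have n3: "near (length (A @ B) * ((length (A @ B) + 2) * (2 * D + 1) * (D + 1) * cost))
        (lval A \<otimes> (\<one> \<otimes> lval B)) \<one>"
      by (simp only: near_one)
    have eq1: "lval ws = ev e \<otimes> lval A \<otimes> (ev e' \<otimes> lval B)"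
      using ent by (simp add: Cons e' lval_append m_assoc)
    have eq2: "lval A \<otimes> ev e \<otimes> (ev e' \<otimes> lval B) = lval A \<otimes> ((ev e \<otimes> ev e') \<otimes> lval B)"
      using ent by (simp add: m_assoc)
    let ?L = "length (A @ B)"
    have "near (length A * ?a + (length u * length u * cost +
        ?L * ((?L + 2) * (2 * D + 1) * (D + 1) * cost))) (lval ws) \<one>"
      using near_trans[OF n1[folded eq1, unfolded eq2] near_trans[OF n2 n3]] .
    moreover have "length A * ?a + (length u * length u * cost +
        ?L * ((?L + 2) * (2 * D + 1) * (D + 1) * cost))
      \<le> length ws * ((length ws + 2) * (2 * D + 1) * (D + 1) * cost)"
    proof -
      \<comment> \<open>One cancellation costs at most \<open>(?L + 1) * ?E\<close>, and raising the
        length from \<open>?L\<close> to \<open>?L + 2\<close> enlarges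
        \<open>length * (length + 2) * ?E\<close> by at least that.\<close>
      let ?E = "(2 * D + 1) * (D + 1) * cost"
      have lw: "length ws = ?L + 2" using Cons e' by simp
      have "?a \<le> ?E" by (simp add: mult_le_mono)
      then have "length A * ?a \<le> ?L * ?E" by (intro mult_le_mono) simp_all
      moreover have "length u * length u * cost \<le> ?E"
        using lu by (intro mult_le_mono) simp_all
      moreover have "?L * ((?L + 2) * (2 * D + 1) * (D + 1) * cost) = ?L * (?L + 2) * ?E"
        by (simp only: ac_simps)
      ultimately have "length A * ?a + (length u * length u * cost +
        ?L * ((?L + 2) * (2 * D + 1) * (D + 1) * cost)) \<le> ?L * ?E + (?E + ?L * (?L + 2) * ?E)"
        by linarith
      also have "\<dots> = (?L + 1 + ?L * (?L + 2)) * ?E" by (simp only: distrib_right) simp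
      also have "\<dots> \<le> ((?L + 2) * (?L + 4)) * ?E" by (intro mult_le_mono1) (simp add: algebra_simps)
      also have "\<dots> = length ws * ((length ws + 2) * (2 * D + 1) * (D + 1) * cost)"
      proof -
        have "?L + 4 = ?L + 2 + 2" by simp
        then show ?thesis unfolding lw by (simp only: mult.assoc)
      qed
      finally show ?thesis .
    qed
    ultimately show ?thesis using near_mono near_one by blast
  qed
qed

section \<open>Words in the letters as products of conjugated commutators\<close>

lemma br_entries:
  assumes "j < K" "set v \<subseteq> {..<K}"
  shows "\<exists>ws. set ws \<subseteq> entries K s \<and> length ws = length v \<and>
    (\<forall>e\<in>set ws. length (fst e) < length v) \<and> br (tt j) (wval v) = lval ws"
  using assms(2)
proof (induction v)
  case Nil
  show ?case using tt_closed[OF assms(1)] by (intro exI[of _ "[]"]) (simp add: br_def)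
next
  case (Cons i v)
  have i: "i < K" "tt i \<in> carrier M" and v: "set v \<subseteq> {..<K}" using Cons.prems tt_closed by auto
  have j: "tt j \<in> carrier M" using assms(1) tt_closed by simp
  obtain ws where ws: "set ws \<subseteq> entries K s" "length ws = length v"
    "\<forall>e\<in>set ws. length (fst e) < length v" "br (tt j) (wval v) = lval ws"
    using Cons.IH[OF v] by blast
  obtain h where h: "h < s" "hh h = br (tt j) (tt i)" using br_tt assms(1) i(1) by blast
  have en: "([], h, True) \<in> entries K s" using h by (simp add: entries_def)
  \<comment> \<open>Each letter of the word contributes one commutator of letters, which is among
    the \<open>hh\<close>, conjugated by the letters before it.\<close>
  have "br (tt j) (wval (i # v)) = br (tt j) (tt i) \<otimes> (tt i \<otimes> br (tt j) (wval v) \<otimes> inv (tt i))"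
    using i j v by (simp add: br_def group_word_simps)
  also have "\<dots> = lval (([], h, True) # shift [i] ws)"
    using lval_shift[OF ws(1), of "[i]"] i j h ws(4) br_closed
    by (simp add: ev_def hval_def)
  finally have "br (tt j) (wval (i # v)) = lval (([], h, True) # shift [i] ws)" .
  moreover have "set (([], h, True) # shift [i] ws) \<subseteq> entries K s"
    using set_shift_entries[OF ws(1), of "[i]"] i en by simp
  moreover have "length (fst e) < length (i # v)" if m: "e \<in> set (([], h, True) # shift [i] ws)" for e
  proof (cases "e = ([], h, True)")
    case False
    then obtain e' where e': "e' \<in> set ws" "e = shift_entry [i] e'"
      using m by (simp add: shift_def) blast
    then have "length (fst e') < length v" using ws(3) by blast
    then show ?thesis using e'(2) by (cases e') simp
  qed simp
  moreover have "length (([], h, True) # shift [i] ws) = length (i # v)" using ws(2) by simp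
  ultimately show ?case by blast
qed

text \<open>The first letter and an occurrence of its inverse are removed together:
  \<open>t a t^-1 b\<close> equals \<open>[t, a] a b\<close>, where the commutator gives
  \<open>length a\<close> entries and \<open>a b\<close> is again balanced.\<close>

lemma balanced_entries:
  assumes "set v \<subseteq> {..<K}" "\<And>j. j < K \<Longrightarrow> count (mset v) j = count (mset v) (bar j)"
  shows "\<exists>ws. set ws \<subseteq> entries K s \<and> length ws \<le> length v * length v \<and>
    (\<forall>e\<in>set ws. length (fst e) \<le> length v) \<and> wval v = lval ws"
  using assms
proof (induction "length v" arbitrary: v rule: less_induct)
  case less
  show ?case
  proof (cases v)
    case Nil
    then show ?thesis by (intro exI[of _ "[]"]) simp
  next
    case (Cons j r)
    have j: "j < K" using less.prems(1) Cons by simp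
    have "count (mset v) (bar j) \<noteq> 0" using less.prems(2)[OF j] Cons by simp
    then have "bar j \<in> set r" using bar(2)[OF j] Cons
      by (metis count_mset_0_iff set_ConsD)
    then obtain a b where r: "r = a @ bar j # b" by (meson split_list)
    have v: "v = j # a @ bar j # b" using Cons r by simp
    have ab: "set a \<subseteq> {..<K}" "set b \<subseteq> {..<K}" using less.prems(1) v by auto
    have cv: "count (mset v) i = count (mset (a @ b)) i + (if i = j \<or> i = bar j then 1 else 0)" for i
      using bar(2)[OF j] by (auto simp: v)
    have "count (mset (a @ b)) i = count (mset (a @ b)) (bar i)" if i: "i < K" for i
    proof -
      have "bar i = j \<or> bar i = bar j \<longleftrightarrow> i = j \<or> i = bar j"
        using bar(3)[OF i] bar(3)[OF j] by metis
      then show ?thesis using less.prems(2)[OF i] cv[of i] cv[of "bar i"] by presburger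
    qed
    moreover have "length (a @ b) < length v" "set (a @ b) \<subseteq> {..<K}" using ab by (simp_all add: v)
    ultimately obtain ws where ws: "set ws \<subseteq> entries K s" "length ws \<le> length (a @ b) * length (a @ b)"
      "\<forall>e\<in>set ws. length (fst e) \<le> length (a @ b)" "wval (a @ b) = lval ws"
      using less.hyps[of "a @ b"] by blast
    obtain us where us: "set us \<subseteq> entries K s" "length us = length a"
      "\<forall>e\<in>set us. length (fst e) < length a" "br (tt j) (wval a) = lval us"
      using br_entries[OF j ab(1)] by blast
    have "wval v = br (tt j) (wval a) \<otimes> wval (a @ b)"
      using ab j tt_closed[OF j] bar(1)[OF j]
      by (simp add: v wval_append tt_bar br_def group_word_simps)
    then have "wval v = lval (us @ ws)" using us ws by (simp add: lval_append)
    moreover have "length (us @ ws) \<le> length v * length v"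
      using us(2) ws(2) by (simp add: v algebra_simps)
    moreover have "length (fst e) \<le> length v" if "e \<in> set (us @ ws)" for e
    proof (cases "e \<in> set us")
      case True
      then have "length (fst e) < length a" using us(3) by blast
      then show ?thesis by (simp add: v)
    next
      case False
      then have "length (fst e) \<le> length (a @ b)" using that ws(3) by simp
      then show ?thesis by (simp add: v)
    qed
    moreover have "set (us @ ws) \<subseteq> entries K s" using us(1) ws(1) by simp
    ultimately show ?thesis by blast
  qed
qed

end

section \<open>Schreier rewriting and the area bound\<close>

text \<open>\<open>rewrite\<close> is the Schreier step for the representatives \<open>Z\<close>.
  They may repeat cosets, so the last representative reached by a relation need not be 1;
  \<open>rewrite_last\<close> disposes of it. \<open>balanced\<close> is the trace left by
  independence in the quotient.\<close>

locale schreier = sorting M R H K s tt hh bar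
  for M (structure) and R and H and K s :: nat and tt hh :: "nat \<Rightarrow> 'a" and bar +
  fixes X Z :: "'a set" and d :: nat
  assumes H_normal: "normal H M"
    and N_H: "normal_closure M R \<subseteq> H"
    and X_carrier: "X \<subseteq> carrier M" and Z_carrier: "Z \<subseteq> carrier M" and one_Z: "\<one> \<in> Z"
    and rewrite: "z \<in> Z \<Longrightarrow> x \<in> X \<Longrightarrow> \<exists>h<s. \<exists>v. \<exists>z'\<in>Z. set v \<subseteq> {..<K} \<and> length v \<le> d \<and>
        z \<otimes> x = hh h \<otimes> list_prod M (map tt v) \<otimes> z'"
    and rewrite_last: "z \<in> Z \<Longrightarrow> g \<in> H \<Longrightarrow> set v \<subseteq> {..<K} \<Longrightarrow> z = g \<otimes> list_prod M (map tt v) \<Longrightarrow>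
        \<exists>h<s. \<exists>v'. set v' \<subseteq> {..<K} \<and> length v' \<le> d \<and> z = hh h \<otimes> list_prod M (map tt v')"
    and balanced: "set v \<subseteq> {..<K} \<Longrightarrow> list_prod M (map tt v) \<in> H \<Longrightarrow> j < K \<Longrightarrow>
        count (mset v) j = count (mset v) (bar j)"
begin

lemma ev_H: "e \<in> entries K s \<Longrightarrow> ev e \<in> H"
  using normal.inv_op_closed2[OF H_normal] hval_H by (auto simp: entries_def ev_def)

lemma lval_H: "set ws \<subseteq> entries K s \<Longrightarrow> lval ws \<in> H"
proof (induction ws)
  case Nil
  then show ?case using normal_imp_subgroup[OF H_normal] by (simp add: subgroup.one_closed)
next
  case (Cons e ws)
  then show ?case using normal_imp_subgroup[OF H_normal] ev_H by (simp add: subgroup.m_closed)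
qed

text \<open>The letters collected so far are carried along as \<open>v\<close>: reading
  \<open>x\<close> turns \<open>v z x\<close> into \<open>(v h v^-1) (v y) z'\<close>. Every
  generator thus yields one entry and lengthens the word by at most \<open>d\<close>.\<close>

lemma rewrite_word:
  assumes "set xs \<subseteq> X" "set v \<subseteq> {..<K}" "z \<in> Z"
  shows "\<exists>ws v' z'. set ws \<subseteq> entries K s \<and> length ws = length xs \<and>
      (\<forall>e\<in>set ws. length (fst e) \<le> length v + d * length xs) \<and>
      set v' \<subseteq> {..<K} \<and> length v' \<le> length v + d * length xs \<and> z' \<in> Z \<and>
      wval v \<otimes> z \<otimes> list_prod M xs = lval ws \<otimes> wval v' \<otimes> z'"
  using assms
proof (induction xs arbitrary: v z)
  case Nil
  then have "wval v \<in> carrier M" "z \<in> carrier M" using Z_carrier by auto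
  then show ?case using Nil by (intro exI[of _ "[]"] exI[of _ v] exI[of _ z]) simp
next
  case (Cons x xs)
  have x: "x \<in> X" "x \<in> carrier M" and xs: "set xs \<subseteq> X" using Cons.prems X_carrier by auto
  then have lx: "list_prod M xs \<in> carrier M" using X_carrier by auto
  have z: "z \<in> carrier M" using Cons.prems Z_carrier by auto
  obtain h y z1 where h: "h < s" "z1 \<in> Z" "set y \<subseteq> {..<K}" "length y \<le> d"
    "z \<otimes> x = hh h \<otimes> wval y \<otimes> z1"
    using rewrite[OF Cons.prems(3) x(1)] unfolding wval_def by blast
  have z1: "z1 \<in> carrier M" using h Z_carrier by auto
  have vy: "set (v @ y) \<subseteq> {..<K}" using Cons.prems(2) h(3) by simp
  let ?e = "(v, h, True) :: entry"
  have e: "?e \<in> entries K s" using h Cons.prems by (simp add: entries_def)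
  obtain ws v' z' where ws: "set ws \<subseteq> entries K s" "length ws = length xs"
      "\<forall>e\<in>set ws. length (fst e) \<le> length (v @ y) + d * length xs"
      "set v' \<subseteq> {..<K}" "length v' \<le> length (v @ y) + d * length xs" "z' \<in> Z"
      "wval (v @ y) \<otimes> z1 \<otimes> list_prod M xs = lval ws \<otimes> wval v' \<otimes> z'"
    using Cons.IH[OF xs vy h(2)] by blast
  have hc: "hh h \<in> carrier M" using h hh_H H_closed by blast
  have z': "z' \<in> carrier M" using ws Z_carrier by auto
  have "wval v \<otimes> z \<otimes> list_prod M (x # xs) = wval v \<otimes> (z \<otimes> x) \<otimes> list_prod M xs"
    using Cons.prems x z lx by (simp add: m_assoc)
  also have "\<dots> = ev ?e \<otimes> (wval (v @ y) \<otimes> z1 \<otimes> list_prod M xs)"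
    unfolding h(5) using Cons.prems h z1 lx hc
    by (simp add: ev_def hval_def wval_append group_word_simps)
  also have "\<dots> = lval (?e # ws) \<otimes> wval v' \<otimes> z'"
    unfolding ws(7) using e ws z' by (simp add: m_assoc)
  finally have "wval v \<otimes> z \<otimes> list_prod M (x # xs) = lval (?e # ws) \<otimes> wval v' \<otimes> z'" .
  moreover have le: "length (v @ y) + d * length xs \<le> length v + d * length (x # xs)"
    using h(4) by simp
  moreover have "length (fst e) \<le> length v + d * length (x # xs)" if m: "e \<in> set (?e # ws)" for e
  proof (cases "e = ?e")
    case False
    then have "length (fst e) \<le> length (v @ y) + d * length xs" using m ws(3) by simp
    then show ?thesis using le by linarith
  qed simp
  moreover have "set (?e # ws) \<subseteq> entries K s" "length (?e # ws) = length (x # xs)"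
    using ws e by simp_all
  moreover have "length v' \<le> length v + d * length (x # xs)" using ws(5) le by linarith
  ultimately show ?case using ws(4,6) by blast
qed

text \<open>The \<open>n\<close> rewriting steps and the removal of the last representative each add
  at most \<open>d\<close> letters, hence \<open>d * (n + 1)\<close>. The remaining word in the
  letters lies in \<open>H\<close>, so it is balanced and dissolves into at most
  \<open>D * D\<close> entries.\<close>

lemma entries_of_relation:
  assumes xs: "set xs \<subseteq> X" and N: "list_prod M xs \<in> normal_closure M R"
    and n: "length xs \<le> n" and D: "D = d * (n + 1)"
  obtains ws where "set ws \<subseteq> entries K s" "length ws \<le> n + 1 + D * D"
    "\<And>e. e \<in> set ws \<Longrightarrow> length (fst e) \<le> D" "list_prod M xs = lval ws"
proof -
  obtain ws v z where ws: "set ws \<subseteq> entries K s" "length ws = length xs"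
      "\<forall>e\<in>set ws. length (fst e) \<le> d * length xs"
      "set v \<subseteq> {..<K}" "length v \<le> d * length xs" "z \<in> Z"
      "\<one> \<otimes> \<one> \<otimes> list_prod M xs = lval ws \<otimes> wval v \<otimes> z"
    using rewrite_word[OF xs _ one_Z, of "[]"] by auto
  have dn: "d * length xs \<le> d * n" using n by simp
  have lx: "list_prod M xs \<in> carrier M" using xs X_carrier by auto
  have z: "z \<in> carrier M" using ws Z_carrier by auto
  have eq: "list_prod M xs = lval ws \<otimes> wval v \<otimes> z" using ws(7) lx by simp
  interpret H: subgroup H M using normal_imp_subgroup[OF H_normal] .
  let ?g = "inv (lval ws) \<otimes> list_prod M xs"
  have g: "?g \<in> H" using lval_H[OF ws(1)] N N_H by blast
  have vz: "wval v \<otimes> z = ?g" using ws z by (simp add: eq m_assoc)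
  define v1 where "v1 = map bar (rev v)"
  have v1: "set v1 \<subseteq> {..<K}" "wval v1 = inv (wval v)" using wval_inv[OF ws(4)] by (auto simp: v1_def)
  have "z = (inv (wval v) \<otimes> (wval v \<otimes> z) \<otimes> wval v) \<otimes> wval v1"
    using ws z v1 by (simp add: m_assoc)
  then have "z = (inv (wval v) \<otimes> ?g \<otimes> wval v) \<otimes> wval v1" unfolding vz .
  moreover have "inv (wval v) \<otimes> ?g \<otimes> wval v \<in> H"
    using normal.inv_op_closed1[OF H_normal] g ws(4) by simp
  ultimately obtain h y where h: "h < s" "set y \<subseteq> {..<K}" "length y \<le> d" "z = hh h \<otimes> wval y"
    using rewrite_last[OF ws(6) _ v1(1)] unfolding wval_def by metis
  have hc: "hh h \<in> carrier M" using h hh_H H_closed by blast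
  let ?e = "(v, h, True) :: entry"
  have e: "?e \<in> entries K s" using h ws by (simp add: entries_def)
  have vy: "set (v @ y) \<subseteq> {..<K}" using ws h by simp
  have vz2: "wval v \<otimes> z = ev ?e \<otimes> wval (v @ y)"
    using h hc ws by (simp add: ev_def hval_def wval_append group_word_simps)
  have "wval (v @ y) = inv (ev ?e) \<otimes> ?g"
    unfolding vz[symmetric] vz2 using e vy by simp
  then have "wval (v @ y) \<in> H" using ev_H[OF e] g by simp
  then obtain us where us: "set us \<subseteq> entries K s" "length us \<le> length (v @ y) * length (v @ y)"
    "\<forall>e\<in>set us. length (fst e) \<le> length (v @ y)" "wval (v @ y) = lval us"
    using balanced_entries[OF vy] balanced[OF vy] unfolding wval_def by blast
  have lvy: "length (v @ y) \<le> D" using order_trans[OF ws(5) dn] h(3) by (simp add: D)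
  show ?thesis
  proof (rule that)
    show "set (ws @ ?e # us) \<subseteq> entries K s" using ws us e by simp
    have "length us \<le> D * D" using us(2) mult_le_mono[OF lvy lvy] by linarith
    then show "length (ws @ ?e # us) \<le> n + 1 + D * D" using ws(2) n by simp
    show "length (fst e') \<le> D" if m: "e' \<in> set (ws @ ?e # us)" for e'
    proof -
      consider "e' \<in> set ws" | "e' = ?e" | "e' \<in> set us" using m by auto
      then show ?thesis
      proof cases
        case 1
        then have "length (fst e') \<le> d * n" using ws(3) dn order_trans by blast
        then show ?thesis by (simp add: D)
      next
        case 2
        then show ?thesis using lvy by simp
      next
        case 3
        then have "length (fst e') \<le> length (v @ y)" using us(3) by blast
        then show ?thesis using lvy by linarith
      qed
    qed
    show "list_prod M xs = lval (ws @ ?e # us)"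
      using eq vz2 us e ws z by (simp add: lval_append m_assoc)
  qed
qed

section \<open>The submodule of relations and the area bound\<close>

definition relations :: "entry list set" where
  "relations = {ws. set ws \<subseteq> entries K s \<and> lval ws \<in> normal_closure M R}"

sublocale shift_closed K s relations
proof
  fix ws vs a
  show "ws \<in> relations \<Longrightarrow> set ws \<subseteq> entries K s" by (simp add: relations_def)
  show "[] \<in> relations" by (simp add: relations_def normal_closure_one)
  show "vs \<in> relations \<Longrightarrow> ws \<in> relations \<Longrightarrow> vs @ ws \<in> relations"
    by (simp add: relations_def lval_append normal_closure_mult)
  show "ws \<in> relations \<Longrightarrow> inv_word ws \<in> relations"
    by (simp add: relations_def lval_inv_word set_inv_word_entries normal_closure_inv)
  show "shift a ws \<in> relations" if w: "ws \<in> relations" and a: "set a \<subseteq> {..<K}"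
    using w set_shift_entries[OF _ a] normal_closure_conj[OF _ wval_closed[OF a]]
    by (simp add: relations_def lval_shift[OF _ a])
qed

theorem area_bound:
  "\<exists>E C. \<forall>n D xs. set xs \<subseteq> X \<longrightarrow> length xs \<le> n \<longrightarrow> D = d * (n + 1) \<longrightarrow>
      list_prod M xs \<in> normal_closure M R \<longrightarrow>
      area (E * (((n + 1 + D * D) * C ^ (s * (D + 1) ^ K))\<^sup>2 * (D + 1)\<^sup>2)) (list_prod M xs)"
proof -
  obtain W C where W: "finite W" "W \<subseteq> relations" and C0: "0 < C" and C:
    "\<forall>ws\<in>relations. \<forall>D. (\<forall>\<kappa>. cnt ws \<kappa> \<noteq> 0 \<longrightarrow> fst \<kappa> \<le> D) \<longrightarrow>
      (\<exists>ps. set ps \<subseteq> {a. set a \<subseteq> {..<K} \<and> length a \<le> D} \<times> W \<and>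
        length ps \<le> length ws * C ^ (s * (D + 1) ^ K) \<and> cnt ws = cnt (spread ps))"
    using bounded_reduction by blast
  have Wval: "lval V \<in> normal_closure M R" "set V \<subseteq> entries K s" if "V \<in> W" for V
    using that W by (auto simp: relations_def)
  obtain A where A: "\<And>V. V \<in> W \<Longrightarrow> area A (lval V)"
    using uniform_area_bound[OF W(1), of lval] Wval by blast
  obtain L where L: "\<And>V. V \<in> W \<Longrightarrow> length V \<le> L"
    using W(1) by (meson finite_imageI[THEN finite_nat_set_iff_bounded_le[THEN iffD1]] imageI)
  have "finite (\<Union>V\<in>W. (\<lambda>e. length (fst e)) ` set V)" using W(1) by simp
  then obtain c where "\<forall>m\<in>(\<Union>V\<in>W. (\<lambda>e. length (fst e)) ` set V). m \<le> c"
    using finite_nat_set_iff_bounded_le by blast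
  then have c: "length (fst e) \<le> c" if "V \<in> W" "e \<in> set V" for V e using that by blast
  \<comment> \<open>\<open>L\<close> bounds the number of entries of a basis relation,
    \<open>c\<close> the length of their words and \<open>A\<close> its area. The first summand pays
    for sorting, the second for the basis relations themselves.\<close>
  define E where "E = (L + 1) * (L + 3) * ((2 * c + 2) * (c + 1) * cost) + A"
  have spread: "set (spread ps) \<subseteq> entries K s \<and> length (spread ps) \<le> length ps * L \<and>
      area (length ps * A) (lval (spread ps)) \<and> (\<forall>e\<in>set (spread ps). length (fst e) \<le> D + c)"
    if "set ps \<subseteq> {a. set a \<subseteq> {..<K} \<and> length a \<le> D} \<times> W" for ps D
    using that
  proof (induction ps)
    case Nil
    then show ?case using zero by (simp add: spread_def)
  next
    case (Cons p ps)
    obtain a V where p: "p = (a, V)" by force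
    have a: "set a \<subseteq> {..<K}" "length a \<le> D" "V \<in> W" using Cons.prems p by auto
    have sp: "spread (p # ps) = shift a V @ spread ps" by (simp add: spread_def p)
    have ent: "set (shift a V) \<subseteq> entries K s" using set_shift_entries Wval a by blast
    have "area A (lval (shift a V))"
      using area_conj[OF A[OF a(3)] wval_closed[OF a(1)]] lval_shift[OF Wval(2)[OF a(3)] a(1)] by simp
    moreover have "length (fst e) \<le> D + c" if m: "e \<in> set (shift a V)" for e
    proof -
      obtain e' where e': "e' \<in> set V" "e = shift_entry a e'" using m by (auto simp: shift_def)
      have "length (fst (shift_entry a e')) = length a + length (fst e')" by (cases e') simp
      then show ?thesis using c[OF a(3) e'(1)] a(2) e'(2) by simp
    qed
    ultimately show ?case
      using Cons ent L[OF a(3)] area_mult[of A "lval (shift a V)"]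
      unfolding sp by (auto simp: lval_append)
  qed
  show ?thesis
  proof (rule exI[of _ E], rule exI[of _ C], intro allI impI)
    fix n D xs assume xs: "set xs \<subseteq> X" "length xs \<le> n" and D: "D = d * (n + 1)"
      and N: "list_prod M xs \<in> normal_closure M R"
    obtain ws where ws: "set ws \<subseteq> entries K s" "length ws \<le> n + 1 + D * D"
      "\<And>e. e \<in> set ws \<Longrightarrow> length (fst e) \<le> D" "list_prod M xs = lval ws"
      using entries_of_relation[OF xs(1) N xs(2) D] by blast
    have rel: "ws \<in> relations" using ws N by (simp add: relations_def)
    have fD: "fst \<kappa> \<le> D" if "cnt ws \<kappa> \<noteq> 0" for \<kappa>
    proof -
      obtain e where e: "e \<in> set ws" "\<kappa> = key e" using \<open>cnt ws \<kappa> \<noteq> 0\<close> cnt_eq_0 by blast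
      have "fst (key e) = length (fst e)" by (cases e) simp
      then show ?thesis using ws(3)[OF e(1)] e(2) by simp
    qed
    define P where "P = n + 1 + D * D"
    define Q where "Q = C ^ (s * (D + 1) ^ K)"
    obtain ps where ps: "set ps \<subseteq> {a. set a \<subseteq> {..<K} \<and> length a \<le> D} \<times> W"
        "length ps \<le> length ws * Q" "cnt ws = cnt (spread ps)"
      using C rel fD unfolding Q_def by blast
    have psPQ: "length ps \<le> P * Q"
      using ps(2) mult_le_mono1[OF ws(2)[folded P_def], of Q] by linarith
    note sp = spread[OF ps(1)]
    define F where "F = P * Q"
    have Q1: "1 \<le> Q" using C0 by (simp add: Q_def Suc_le_eq)
    then have PF: "P \<le> F" by (simp add: F_def)
    then have F1: "1 \<le> F" by (simp add: P_def)
    \<comment> \<open>Both factors have the same formal sum, so \<open>us\<close> is balanced and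
      costs only sorting; what remains is \<open>spread ps\<close>, a product of conjugates of basis
      relations.\<close>
    define us where "us = ws @ inv_word (spread ps)"
    have us: "set us \<subseteq> entries K s" using ws(1) sp set_inv_word_entries by (simp add: us_def)
    have "cnt us = (\<lambda>_. 0)" by (rule ext) (simp add: us_def ps(3))
    moreover have "length (fst e) \<le> D + c" if m: "e \<in> set us" for e
    proof (cases "e \<in> set ws")
      case True
      then show ?thesis using ws(3) trans_le_add1 by blast
    next
      case False
      then obtain e' where "e' \<in> set (spread ps)" "e = inv_entry e'"
        using m by (auto simp: us_def set_inv_word)
      moreover have "fst (inv_entry x) = fst x" for x by (cases x) simp
      ultimately show ?thesis using sp by simp
    qed
    ultimately have "area (length us * ((length us + 2) * (2 * (D + c) + 1) * (D + c + 1) * cost)) (lval us)"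
      using area_of_balanced_entries[OF us] by blast
    then have "area (length us * ((length us + 2) * (2 * (D + c) + 1) * (D + c + 1) * cost)
        + length ps * A) (lval us \<otimes> lval (spread ps))"
      using sp by (intro area_mult) auto
    moreover have "lval us \<otimes> lval (spread ps) = list_prod M xs"
      using ws sp set_inv_word_entries by (simp add: us_def lval_append lval_inv_word m_assoc)
    moreover have "length us * ((length us + 2) * (2 * (D + c) + 1) * (D + c + 1) * cost)
        + length ps * A \<le> E * (F\<^sup>2 * (D + 1)\<^sup>2)"
    proof -
      have "length us \<le> P + F * L"
        using ws(2)[folded P_def] sp mult_le_mono1[OF psPQ[folded F_def], of L]
        unfolding us_def length_append length_inv_word by linarith
      also have "\<dots> \<le> F * (L + 1)" using PF by simp
      finally have l1: "length us \<le> F * (L + 1)" .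
      have "length us + 2 \<le> F * (L + 1) + 2 * F" using l1 F1 by linarith
      also have "\<dots> = F * (L + 3)" by (simp add: algebra_simps)
      finally have l2: "length us + 2 \<le> F * (L + 3)" .
      have l3: "2 * (D + c) + 1 \<le> (2 * c + 2) * (D + 1)" "D + c + 1 \<le> (c + 1) * (D + 1)"
        by (simp_all add: algebra_simps)
      have "length us * ((length us + 2) * (2 * (D + c) + 1) * (D + c + 1) * cost)
          \<le> F * (L + 1) * (F * (L + 3) * ((2 * c + 2) * (D + 1)) * ((c + 1) * (D + 1)) * cost)"
        by (intro mult_le_mono l1 l2 l3 order_refl)
      also have "\<dots> = (L + 1) * (L + 3) * ((2 * c + 2) * (c + 1) * cost) * (F\<^sup>2 * (D + 1)\<^sup>2)"
        by (simp only: power2_eq_square ac_simps)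
      finally have a: "length us * ((length us + 2) * (2 * (D + c) + 1) * (D + c + 1) * cost)
          \<le> (L + 1) * (L + 3) * ((2 * c + 2) * (c + 1) * cost) * (F\<^sup>2 * (D + 1)\<^sup>2)" .
      have "length ps * 1 \<le> F * (F * (D + 1)\<^sup>2)"
        using psPQ F1 by (intro mult_le_mono) (auto simp: F_def)
      then have "length ps \<le> F\<^sup>2 * (D + 1)\<^sup>2"
        by (simp only: power2_eq_square mult_1_right mult.assoc)
      then have "length ps * A \<le> A * (F\<^sup>2 * (D + 1)\<^sup>2)"
        unfolding mult.commute[of "length ps"] by (rule mult_le_mono2)
      then show ?thesis using a unfolding E_def by (simp only: distrib_right)
    qed
    ultimately have "area (E * (F\<^sup>2 * (D + 1)\<^sup>2)) (list_prod M xs)" using area_mono by simp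
    then show "area (E * (((n + 1 + D * D) * C ^ (s * (D + 1) ^ K))\<^sup>2 * (D + 1)\<^sup>2)) (list_prod M xs)"
      by (simp add: F_def P_def Q_def)
  qed
qed

end

section \<open>Finite index and torsion-free rank\<close>

text \<open>A finite supremum of natural numbers is attained: otherwise \<open>k - 1\<close> would
  be an upper bound, with \<open>k > 0\<close> because the empty set is independent.\<close>

lemma ex_Z_independent_of_rank:
  assumes "torsion_free_rank T = enat k" and "group T"
  obtains S where "Z_independent T S" "card S = k"
    "\<And>S'. Z_independent T S' \<Longrightarrow> card S' \<le> k"
proof -
  have le: "card S' \<le> k" if "Z_independent T S'" for S'
  proof -
    have "enat (card S') \<le> torsion_free_rank T"
      unfolding torsion_free_rank_def by (rule SUP_upper) (use that in simp)
    then show ?thesis using assms(1) by simp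
  qed
  have "\<exists>S. Z_independent T S \<and> card S = k"
  proof (rule ccontr)
    assume "\<not> ?thesis"
    then have lt: "card S' < k" if "Z_independent T S'" for S' using le[OF that] that by fastforce
    have "Z_independent T {}" by (simp add: Z_independent_def)
    then have k: "0 < k" using lt by fastforce
    have "torsion_free_rank T \<le> enat (k - 1)"
      unfolding torsion_free_rank_def
    proof (rule SUP_least)
      fix S' assume "S' \<in> {S. Z_independent T S}"
      then show "enat (card S') \<le> enat (k - 1)" using lt[of S'] by simp
    qed
    then show False using assms(1) k by simp
  qed
  then show ?thesis using that le by blast
qed

context comm_group
begin

lemma finprod_in_subgroup:
  assumes "subgroup P G" "f \<in> A \<rightarrow> P"
  shows "finprod G f A \<in> P"
proof -
  have P: "P \<subseteq> carrier G" using assms(1) by (rule subgroup.subset)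
  show ?thesis using assms(2)
  proof (induction A rule: infinite_finite_induct)
    case (insert a A)
    then have "f a \<in> P" "finprod G f A \<in> P" "f a \<in> carrier G" "f \<in> A \<rightarrow> carrier G"
      using P by auto
    then show ?case using insert.hyps subgroup.m_closed[OF assms(1)] by simp
  qed (simp_all add: subgroup.one_closed[OF assms(1)])
qed

text \<open>Adding \<open>x\<close> to a maximal independent set creates a dependence. The exponent
  of \<open>x\<close> in it is nonzero since \<open>S\<close> is independent, and solving for that
  power puts it into the subgroup.\<close>

lemma power_in_generate_of_maximal:
  assumes S: "Z_independent G S" and max: "\<And>S'. Z_independent G S' \<Longrightarrow> card S' \<le> card S"
    and x: "x \<in> carrier G"
  shows "\<exists>m>0. x [^] (m::nat) \<in> generate G S"
proof -
  have SG: "S \<subseteq> carrier G" "finite S" using S by (auto simp: Z_independent_def)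
  have sub: "subgroup (generate G S) G" using generate_is_subgroup[OF SG(1)] .
  show ?thesis
  proof (cases "x \<in> S")
    case True
    then have "x [^] (1::nat) \<in> generate G S" using x generate.incl[of x S G] by simp
    then show ?thesis by blast
  next
    case False
    have "\<not> Z_independent G (insert x S)"
    proof
      assume "Z_independent G (insert x S)"
      then have "card (insert x S) \<le> card S" by (rule max)
      then show False using False SG by simp
    qed
    then obtain c :: "'a \<Rightarrow> int" where c: "(\<Otimes>s\<in>insert x S. s [^] c s) = \<one>"
      "\<exists>s\<in>insert x S. c s \<noteq> 0"
      using SG x unfolding Z_independent_def by blast
    let ?f = "\<lambda>s. s [^] c s"
    have f: "?f \<in> S \<rightarrow> carrier G" "?f x \<in> carrier G" using SG x by auto
    have eq: "?f x \<otimes> finprod G ?f S = \<one>"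
      using c(1) finprod_insert[OF SG(2) False f] by simp
    have cx: "c x \<noteq> 0"
    proof
      assume "c x = 0"
      then have "finprod G ?f S = \<one>" using eq finprod_closed[OF f(1)] by simp
      then have "\<forall>s\<in>S. c s = 0" using S unfolding Z_independent_def by blast
      then show False using c(2) \<open>c x = 0\<close> by blast
    qed
    have "finprod G ?f S \<in> generate G S"
      using SG subgroup_int_pow_closed[OF sub] generate.incl[of _ S G]
      by (intro finprod_in_subgroup[OF sub]) auto
    moreover have "?f x = inv (finprod G ?f S)"
      using eq f finprod_closed[OF f(1)] inv_equality by (metis inv_inv inv_closed)
    ultimately have p: "x [^] c x \<in> generate G S" using subgroup.m_inv_closed[OF sub] by simp
    have "x [^] (nat \<bar>c x\<bar>) \<in> generate G S"
    proof (cases "c x \<ge> 0")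
      case True
      then show ?thesis using p by (simp add: int_pow_int[symmetric])
    next
      case F: False
      then have "x [^] (nat \<bar>c x\<bar>) = x [^] (- c x)" by (simp add: int_pow_int[symmetric])
      also have "\<dots> = inv (x [^] c x)" using x by (rule int_pow_neg)
      finally show ?thesis using subgroup.m_inv_closed[OF sub p] by simp
    qed
    then show ?thesis using cx by (intro exI[of _ "nat \<bar>c x\<bar>"]) simp
  qed
qed

lemma list_prod_collect:
  assumes "x \<in> carrier G" "set xs \<subseteq> carrier G"
  shows "list_prod G xs = x [^] count_list xs x \<otimes> list_prod G (filter (\<lambda>y. y \<noteq> x) xs)"
  using assms(2)
proof (induction xs)
  case (Cons y xs)
  let ?r = "list_prod G (filter (\<lambda>y. y \<noteq> x) xs)"
  have r: "?r \<in> carrier G" using Cons.prems by (intro list_prod_closed) auto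
  have p: "x [^] count_list xs x \<in> carrier G" using assms(1) by simp
  have y: "y \<in> carrier G" using Cons.prems by simp
  have IH: "list_prod G xs = x [^] count_list xs x \<otimes> ?r" using Cons by simp
  show ?case
  proof (cases "y = x")
    case True
    then show ?thesis using IH p r assms(1) by (simp add: m_assoc[symmetric] m_comm[of x])
  next
    case False
    then show ?thesis using IH p r y by (simp add: m_lcomm)
  qed
qed simp

text \<open>Commutativity gathers the powers of each generator, whose exponent matters only modulo
  some \<open>m\<close> with \<open>x^m\<close> in \<open>P\<close>. Products of lists suffice
  because the generating set used later is closed under inverses.\<close>

lemma finite_transversal:
  assumes "finite X" "X \<subseteq> carrier G" "subgroup P G"
    "\<And>x. x \<in> X \<Longrightarrow> \<exists>m>0. x [^] (m::nat) \<in> P"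
  shows "\<exists>Z. finite Z \<and> Z \<subseteq> carrier G \<and>
    (\<forall>xs. set xs \<subseteq> X \<longrightarrow> (\<exists>p\<in>P. \<exists>z\<in>Z. list_prod G xs = p \<otimes> z))"
  using assms(1,2,4)
proof (induction X)
  case empty
  show ?case
    by (rule exI[of _ "{\<one>}"]) (use subgroup.one_closed[OF assms(3)] in \<open>auto intro!: bexI[of _ \<one>]\<close>)
next
  case (insert x X)
  obtain Z where Z: "finite Z" "Z \<subseteq> carrier G"
    "\<forall>xs. set xs \<subseteq> X \<longrightarrow> (\<exists>p\<in>P. \<exists>z\<in>Z. list_prod G xs = p \<otimes> z)"
    using insert.IH insert.prems by auto
  obtain m :: nat where m: "m > 0" "x [^] m \<in> P" using insert.prems(2) by blast
  have x: "x \<in> carrier G" using insert.prems by simp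
  have PG: "P \<subseteq> carrier G" using subgroup.subset[OF assms(3)] .
  let ?Z = "(\<lambda>(j, z). x [^] j \<otimes> z) ` ({..<m} \<times> Z)"
  have "\<exists>p\<in>P. \<exists>z\<in>?Z. list_prod G xs = p \<otimes> z" if xs: "set xs \<subseteq> insert x X" for xs
  proof -
    have "set (filter (\<lambda>y. y \<noteq> x) xs) \<subseteq> X" using xs by auto
    then obtain p z where pz: "p \<in> P" "z \<in> Z" "list_prod G (filter (\<lambda>y. y \<noteq> x) xs) = p \<otimes> z"
      using Z(3) by blast
    have pzc: "p \<in> carrier G" "z \<in> carrier G" using pz PG Z by auto
    define q where "q = count_list xs x div m"
    define j where "j = count_list xs x mod m"
    have xm: "(x [^] m) [^] q \<in> P"
      using subgroup_int_pow_closed[OF assms(3) m(2), of "int q"] by (simp add: int_pow_int)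
    have "m * q + j = count_list xs x" by (simp add: q_def j_def)
    then have "x [^] count_list xs x = (x [^] m) [^] q \<otimes> x [^] j"
      using x by (simp add: nat_pow_pow nat_pow_mult)
    then have "list_prod G xs = ((x [^] m) [^] q \<otimes> x [^] j) \<otimes> (p \<otimes> z)"
      using list_prod_collect[OF x, of xs] xs insert.prems(1) pz(3) by auto
    also have "\<dots> = ((x [^] m) [^] q \<otimes> p) \<otimes> (x [^] j \<otimes> z)"
      using x pzc by (simp add: m_ac)
    finally have "list_prod G xs = ((x [^] m) [^] q \<otimes> p) \<otimes> (x [^] j \<otimes> z)" .
    moreover have "(x [^] m) [^] q \<otimes> p \<in> P" using xm pz subgroup.m_closed[OF assms(3)] by simp
    moreover have "x [^] j \<otimes> z \<in> ?Z" using pz m by (auto simp: j_def)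
    ultimately show ?thesis by blast
  qed
  moreover have "finite ?Z" "?Z \<subseteq> carrier G" using Z x by auto
  ultimately show ?case by blast
qed

end

text \<open>The letters \<open>2 * i\<close> and \<open>2 * i + 1\<close> stand for \<open>t i\<close> and its inverse.\<close>

definition bar_index :: "nat \<Rightarrow> nat" where
  "bar_index j = (if even j then j + 1 else j - 1)"

lemma bar_index:
  "j < 2 * k \<Longrightarrow> bar_index j < 2 * k" "bar_index j \<noteq> j" "bar_index (bar_index j) = j"
  "even (bar_index j) \<longleftrightarrow> odd j" "bar_index j div 2 = j div 2"
  by (auto simp: bar_index_def elim!: evenE oddE)

definition exponent :: "nat list \<Rightarrow> nat \<Rightarrow> int" where
  "exponent v i = int (count (mset v) (2 * i)) - int (count (mset v) (2 * i + 1))"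

definition signed_power :: "('a, 'b) monoid_scheme \<Rightarrow> (nat \<Rightarrow> 'a) \<Rightarrow> nat \<Rightarrow> 'a" where
  "signed_power G t j = (if even j then t (j div 2) else inv\<^bsub>G\<^esub> (t (j div 2)))"

lemma (in group) signed_power_bar:
  "t (j div 2) \<in> carrier G \<Longrightarrow> signed_power G t (bar_index j) = inv (signed_power G t j)"
  by (simp add: signed_power_def bar_index)

text \<open>Links words to \<open>Z_independent\<close>: a trivial product of independent elements
  forces all exponent sums to vanish.\<close>

lemma (in comm_group) list_prod_signed_power:
  assumes "set v \<subseteq> {..<2 * k}" "\<And>i. i < k \<Longrightarrow> t i \<in> carrier G"
  shows "list_prod G (map (signed_power G t) v) = (\<Otimes>i\<in>{..<k}. t i [^] exponent v i)"
  using assms(1)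
proof (induction v)
  case Nil
  then show ?case using assms(2) by (simp add: exponent_def finprod_one_eqI)
next
  case (Cons j v)
  have j: "j div 2 < k" using Cons.prems by auto
  let ?e = "if even j then 1 else -1 :: int"
  have e: "exponent (j # v) i = (if j div 2 = i then ?e else 0) + exponent v i" for i
    by (auto simp: exponent_def elim!: evenE oddE; presburger)
  have "(\<Otimes>i\<in>{..<k}. t i [^] exponent (j # v) i)
      = (\<Otimes>i\<in>{..<k}. (if j div 2 = i then t i [^] ?e else \<one>) \<otimes> t i [^] exponent v i)"
    using assms(2) by (intro finprod_cong) (auto simp: e int_pow_mult simp_implies_def)
  also have "\<dots> = (\<Otimes>i\<in>{..<k}. if j div 2 = i then t i [^] ?e else \<one>) \<otimes>
      (\<Otimes>i\<in>{..<k}. t i [^] exponent v i)"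
    using assms(2) by (intro finprod_multf) auto
  also have "(\<Otimes>i\<in>{..<k}. if j div 2 = i then t i [^] ?e else \<one>) = t (j div 2) [^] ?e"
    using assms(2) j by (intro finprod_singleton) auto
  also have "t (j div 2) [^] ?e = signed_power G t j"
    using assms(2)[OF j] by (simp add: signed_power_def int_pow_neg)
  finally show ?case using Cons by simp
qed

text \<open>Rewriting needs one decomposition for each pair from \<open>Z\<close> and
  \<open>X\<close>. Fixing these finitely many choices in advance makes \<open>s\<close> and
  \<open>d\<close> independent of the word.\<close>

theorem (in relators) area_bound_from_transversal:
  assumes metab: "\<And>x y. x \<in> derived M (carrier M) \<Longrightarrow> y \<in> derived M (carrier M) \<Longrightarrow> x \<otimes> y = y \<otimes> x"
    and H: "normal H M" and dH: "derived M (carrier M) \<subseteq> H" and NH: "normal_closure M R \<subseteq> H"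
    and brH: "\<And>x y. x \<in> H \<Longrightarrow> y \<in> H \<Longrightarrow> br x y \<in> normal_closure M R"
    and t: "\<And>i. i < k \<Longrightarrow> t i \<in> carrier M"
    and X: "finite X" "X \<subseteq> carrier M"
    and Z: "finite Z" "Z \<subseteq> carrier M" "\<one> \<in> Z"
    and trans: "\<And>g. g \<in> carrier M \<Longrightarrow> \<exists>h\<in>H. \<exists>v. \<exists>z\<in>Z. set v \<subseteq> {..<2 * k} \<and>
        g = h \<otimes> list_prod M (map (signed_power M t) v) \<otimes> z"
    and bal: "\<And>v i. set v \<subseteq> {..<2 * k} \<Longrightarrow> list_prod M (map (signed_power M t) v) \<in> H \<Longrightarrow>
        i < k \<Longrightarrow> exponent v i = 0"
  shows "\<exists>d s E C. (k = 0 \<longrightarrow> d = 0) \<and> (\<forall>n D xs. set xs \<subseteq> X \<longrightarrow> length xs \<le> n \<longrightarrow> D = d * (n + 1) \<longrightarrow>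
      list_prod M xs \<in> normal_closure M R \<longrightarrow>
      area (E * (((n + 1 + D * D) * C ^ (s * (D + 1) ^ (2 * k)))\<^sup>2 * (D + 1)\<^sup>2)) (list_prod M xs))"
proof -
  let ?K = "2 * k"
  define tt where "tt = signed_power M t"
  let ?v = "\<lambda>v. list_prod M (map tt v)"
  have HC: "H \<subseteq> carrier M" using normal_imp_subgroup[OF H] by (rule subgroup.subset)
  have ttc: "tt j \<in> carrier M" if "j < ?K" for j
    using t[of "j div 2"] that by (auto simp: tt_def signed_power_def)
  have "\<exists>h v z'. h \<in> H \<and> set v \<subseteq> {..<?K} \<and> z' \<in> Z \<and> fst p \<otimes> snd p = h \<otimes> ?v v \<otimes> z'"
    if "p \<in> Z \<times> X" for p
  proof -
    have "fst p \<in> carrier M" "snd p \<in> carrier M" using that Z(2) X(2) by auto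
    then have "fst p \<otimes> snd p \<in> carrier M" by simp
    then show ?thesis using trans unfolding tt_def by blast
  qed
  then obtain h1 v1 z1 where 1: "\<And>p. p \<in> Z \<times> X \<Longrightarrow> h1 p \<in> H \<and> set (v1 p) \<subseteq> {..<?K} \<and> z1 p \<in> Z \<and>
      fst p \<otimes> snd p = h1 p \<otimes> ?v (v1 p) \<otimes> z1 p" by metis
  \<comment> \<open>The representatives that can end a relation. Their decomposition is chosen for
    \<open>z\<close> alone, whatever \<open>g\<close> and \<open>v\<close> produced it.\<close>
  define Z' where "Z' = {z \<in> Z. \<exists>g\<in>H. \<exists>v. set v \<subseteq> {..<?K} \<and> z = g \<otimes> ?v v}"
  have "\<exists>h v. h \<in> H \<and> set v \<subseteq> {..<?K} \<and> z = h \<otimes> ?v v" if "z \<in> Z'" for z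
    using that by (auto simp: Z'_def)
  then obtain h2 v2 where 2: "\<And>z. z \<in> Z' \<Longrightarrow> h2 z \<in> H \<and> set (v2 z) \<subseteq> {..<?K} \<and> z = h2 z \<otimes> ?v (v2 z)"
    by metis
  \<comment> \<open>All elements of \<open>H\<close> that occur in rewriting, in the last step, or
    as commutators of letters.\<close>
  define H0 where "H0 = h1 ` (Z \<times> X) \<union> h2 ` Z' \<union> (\<lambda>(i, j). br (tt i) (tt j)) ` ({..<?K} \<times> {..<?K})"
  have fZ': "finite Z'" using Z by (simp add: Z'_def)
  then have "finite H0" using X Z by (simp add: H0_def)
  then obtain s hh where hh: "H0 = hh ` {i::nat. i < s}"
    using finite_imp_nat_seg_image_inj_on by metis
  have H0: "H0 \<subseteq> H"
  proof
    fix x assume "x \<in> H0"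
    then consider p where "p \<in> Z \<times> X" "x = h1 p" | z where "z \<in> Z'" "x = h2 z"
      | i j where "i < ?K" "j < ?K" "x = br (tt i) (tt j)" by (auto simp: H0_def)
    then show "x \<in> H"
    proof cases
      case 3
      then show ?thesis using br_in_derived ttc dH by blast
    qed (use 1 2 in auto)
  qed
  have hhH: "hh h \<in> H" if "h < s" for h using that hh H0 by auto
  have ex_h: "\<exists>h<s. x = hh h" if "x \<in> H0" for x using that hh by auto
  have "finite ((\<lambda>p. length (v1 p)) ` (Z \<times> X) \<union> (\<lambda>z. length (v2 z)) ` Z')" using X Z fZ' by simp
  then obtain d0 where d0: "\<forall>l\<in>(\<lambda>p. length (v1 p)) ` (Z \<times> X) \<union> (\<lambda>z. length (v2 z)) ` Z'. l \<le> d0"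
    using finite_nat_set_iff_bounded_le by blast
  \<comment> \<open>Without letters every word is empty. Setting \<open>d\<close> to 0 then makes
    \<open>D\<close> vanish, as the quadratic bound requires.\<close>
  define d where "d = (if k = 0 then 0 else d0)"
  have ld: "length v \<le> d" if "length v \<le> d0" "set v \<subseteq> {..<?K}" for v :: "nat list"
    using that by (auto simp: d_def)
  interpret H: normal H M by (rule H)
  interpret S: schreier M R H ?K s tt hh bar_index X Z d
  proof
    show "x \<otimes> y = y \<otimes> x" if "x \<in> derived M (carrier M)" "y \<in> derived M (carrier M)" for x y
      using metab that .
    show "H \<subseteq> carrier M" by (rule HC)
    show "derived M (carrier M) \<subseteq> H" by (rule dH)
    show "br x y \<in> normal_closure M R" if "x \<in> H" "y \<in> H" for x y using brH that .
    show "tt j \<in> carrier M" if "j < ?K" for j using ttc that .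
    show "bar_index j < ?K" "bar_index j \<noteq> j" "bar_index (bar_index j) = j" if "j < ?K" for j
      using bar_index that by auto
    show "tt (bar_index j) = inv (tt j)" if "j < ?K" for j
      using signed_power_bar[of t j] t[of "j div 2"] that by (auto simp: tt_def)
    show "hh h \<in> H" if "h < s" for h using hhH that .
    show "inv (hh h) \<in> H" if "h < s" for h
      using subgroup.m_inv_closed[OF normal_imp_subgroup[OF H] hhH[OF that]] .
    show "\<exists>h<s. hh h = br (tt i) (tt j)" if "i < ?K" "j < ?K" for i j
    proof -
      have "br (tt i) (tt j) \<in> H0" using that by (auto simp: H0_def)
      then show ?thesis using ex_h by metis
    qed
    show "normal_closure M R \<subseteq> H" by (rule NH)
    show "X \<subseteq> carrier M" "Z \<subseteq> carrier M" "\<one> \<in> Z" using X Z by auto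
    show "\<exists>h<s. \<exists>v. \<exists>z'\<in>Z. set v \<subseteq> {..<?K} \<and> length v \<le> d \<and> z \<otimes> x = hh h \<otimes> ?v v \<otimes> z'"
      if "z \<in> Z" "x \<in> X" for z x
    proof -
      have zx: "(z, x) \<in> Z \<times> X" using that by simp
      then have "h1 (z, x) \<in> H0" unfolding H0_def by blast
      then obtain h where "h < s" "h1 (z, x) = hh h" using ex_h by blast
      moreover have "length (v1 (z, x)) \<le> d" using ld 1[OF zx] d0 zx by blast
      ultimately show ?thesis using 1[OF zx] by auto
    qed
    show "\<exists>h<s. \<exists>v'. set v' \<subseteq> {..<?K} \<and> length v' \<le> d \<and> z = hh h \<otimes> ?v v'"
      if "z \<in> Z" "g \<in> H" "set v \<subseteq> {..<?K}" "z = g \<otimes> ?v v" for z g v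
    proof -
      have z: "z \<in> Z'" using that unfolding Z'_def by blast
      then have "h2 z \<in> H0" unfolding H0_def by blast
      then obtain h where "h < s" "h2 z = hh h" using ex_h by blast
      moreover have "length (v2 z) \<le> d" using ld 2[OF z] d0 z by blast
      ultimately show ?thesis using 2[OF z] by metis
    qed
    show "count (mset v) j = count (mset v) (bar_index j)"
      if "set v \<subseteq> {..<?K}" "?v v \<in> H" "j < ?K" for v j
    proof -
      have "j div 2 < k" using that(3) by auto
      then have "exponent v (j div 2) = 0" using bal that unfolding tt_def by blast
      then show ?thesis by (auto simp: exponent_def bar_index_def elim!: evenE oddE)
    qed
  qed
  have "k = 0 \<longrightarrow> d = 0" by (simp add: d_def)
  then show ?thesis using S.area_bound by blast
qed

lemma (in group_hom) hom_list_prod: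
  "set xs \<subseteq> carrier G \<Longrightarrow> h (list_prod G xs) = list_prod H (map h xs)"
  by (induction xs) (auto simp: G.list_prod_closed)

lemma (in comm_group) generate_signed_power:
  assumes "\<sigma> ` {..<k} = S" "S \<subseteq> carrier G" "p \<in> generate G S"
  shows "\<exists>v. set v \<subseteq> {..<2 * k} \<and> p = list_prod G (map (signed_power G \<sigma>) v)"
proof -
  have \<sigma>: "\<sigma> i \<in> carrier G" if "i < k" for i using that assms(1,2) by blast
  have sp: "signed_power G \<sigma> j \<in> carrier G" if "j < 2 * k" for j
    using \<sigma>[of "j div 2"] that by (auto simp: signed_power_def)
  have sgl: "list_prod G (map (signed_power G \<sigma>) [j]) = signed_power G \<sigma> j" if "j < 2 * k" for j
    using sp[OF that] by simp
  show ?thesis using assms(3)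
  proof (induction rule: generate.induct)
    case one
    show ?case by (rule exI[of _ "[]"]) simp
  next
    case (incl x)
    then obtain i where i: "i < k" "x = \<sigma> i" using assms(1) by blast
    then show ?case using sgl[of "2 * i"]
      by (intro exI[of _ "[2 * i]"]) (simp add: signed_power_def)
  next
    case (inv x)
    then obtain i where i: "i < k" "x = \<sigma> i" using assms(1) by blast
    then show ?case using sgl[of "2 * i + 1"]
      by (intro exI[of _ "[2 * i + 1]"]) (simp add: signed_power_def)
  next
    case (eng x y)
    then obtain u v where uv: "set u \<subseteq> {..<2 * k}" "x = list_prod G (map (signed_power G \<sigma>) u)"
      "set v \<subseteq> {..<2 * k}" "y = list_prod G (map (signed_power G \<sigma>) v)" by blast
    have "list_prod G (map (signed_power G \<sigma>) (u @ v)) = x \<otimes> y"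
      using uv sp unfolding map_append by (subst list_prod_append) auto
    then show ?case using uv by (intro exI[of _ "u @ v"]) simp
  qed
qed

text \<open>\<open>H\<close> is the kernel of \<open>\<phi>\<close>, and the letters lift a maximal
  independent set. Powers of the images of \<open>X\<close> lie in the subgroup it generates, so
  finitely many representatives suffice.\<close>

theorem (in relators) area_bound_from_quotient:
  fixes T :: "('c, 'd) monoid_scheme"
  assumes metab: "\<And>x y. x \<in> derived M (carrier M) \<Longrightarrow> y \<in> derived M (carrier M) \<Longrightarrow> x \<otimes> y = y \<otimes> x"
    and T: "comm_group T" "torsion_free_rank T = enat k"
    and \<phi>: "\<phi> \<in> hom M T" "\<phi> ` carrier M = carrier T"
    and N: "\<And>x. x \<in> normal_closure M R \<Longrightarrow> \<phi> x = \<one>\<^bsub>T\<^esub>"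
    and br: "\<And>x y. x \<in> carrier M \<Longrightarrow> y \<in> carrier M \<Longrightarrow> \<phi> x = \<one>\<^bsub>T\<^esub> \<Longrightarrow> \<phi> y = \<one>\<^bsub>T\<^esub> \<Longrightarrow>
        br x y \<in> normal_closure M R"
    and X: "finite X" "X \<subseteq> carrier M" "\<And>g. g \<in> carrier M \<Longrightarrow> \<exists>xs. set xs \<subseteq> X \<and> g = list_prod M xs"
  shows "\<exists>d s E C. (k = 0 \<longrightarrow> d = 0) \<and> (\<forall>n D xs. set xs \<subseteq> X \<longrightarrow> length xs \<le> n \<longrightarrow> D = d * (n + 1) \<longrightarrow>
      list_prod M xs \<in> normal_closure M R \<longrightarrow>
      area (E * (((n + 1 + D * D) * C ^ (s * (D + 1) ^ (2 * k)))\<^sup>2 * (D + 1)\<^sup>2)) (list_prod M xs))"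
proof -
  interpret T: comm_group T by (rule T)
  interpret \<phi>: group_hom M T \<phi> by unfold_locales (rule \<phi>(1))
  obtain S where S: "Z_independent T S" "card S = k" "\<And>S'. Z_independent T S' \<Longrightarrow> card S' \<le> k"
    using ex_Z_independent_of_rank[OF T(2) T.group_axioms] by blast
  have ST: "finite S" "S \<subseteq> carrier T" using S(1) by (auto simp: Z_independent_def)
  obtain \<sigma> where \<sigma>: "bij_betw \<sigma> {..<k} S"
    using ex_bij_betw_nat_finite[OF ST(1)] S(2) by (auto simp: lessThan_atLeast0)
  have \<sigma>S: "\<sigma> ` {..<k} = S" "inj_on \<sigma> {..<k}" using \<sigma> by (auto simp: bij_betw_def)
  have \<sigma>T: "\<sigma> i \<in> carrier T" if "i < k" for i using that \<sigma>S(1) ST(2) by blast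
  have lift: "\<exists>g. g \<in> carrier M \<and> \<phi> g = y" if "y \<in> carrier T" for y
  proof -
    have "y \<in> \<phi> ` carrier M" using that \<phi>(2) by simp
    then show ?thesis by blast
  qed
  then obtain pick where pick: "\<And>y. y \<in> carrier T \<Longrightarrow> pick y \<in> carrier M \<and> \<phi> (pick y) = y" by metis
  define t where "t i = pick (\<sigma> i)" for i
  have t: "t i \<in> carrier M" "\<phi> (t i) = \<sigma> i" if "i < k" for i
    using pick \<sigma>T[OF that] by (auto simp: t_def)
  have spc: "signed_power M t j \<in> carrier M" "\<phi> (signed_power M t j) = signed_power T \<sigma> j"
    if "j < 2 * k" for j
    using t[of "j div 2"] that by (auto simp: signed_power_def)
  have vc: "list_prod M (map (signed_power M t) v) \<in> carrier M"
    and v\<phi>: "\<phi> (list_prod M (map (signed_power M t) v)) = list_prod T (map (signed_power T \<sigma>) v)"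
    if "set v \<subseteq> {..<2 * k}" for v
  proof -
    have s: "set (map (signed_power M t) v) \<subseteq> carrier M" using that spc(1) by auto
    then show "list_prod M (map (signed_power M t) v) \<in> carrier M" by (rule list_prod_closed)
    have "map (\<phi> \<circ> signed_power M t) v = map (signed_power T \<sigma>) v"
      using that spc(2) by (intro map_cong) auto
    then show "\<phi> (list_prod M (map (signed_power M t) v)) = list_prod T (map (signed_power T \<sigma>) v)"
      using \<phi>.hom_list_prod[OF s] by (simp only: map_map)
  qed
  let ?H = "kernel M T \<phi>"
  let ?P = "generate T S"
  have sub: "subgroup ?P T" using T.generate_is_subgroup[OF ST(2)] .
  have pow: "\<exists>m>0. x [^]\<^bsub>T\<^esub> (m::nat) \<in> ?P" if "x \<in> \<phi> ` X" for x
    using T.power_in_generate_of_maximal[OF S(1)] S(2,3) that X(2) by auto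
  have \<phi>X: "finite (\<phi> ` X)" "\<phi> ` X \<subseteq> carrier T" using X(1,2) by auto
  obtain Z0 where Z0: "finite Z0" "Z0 \<subseteq> carrier T"
    "\<forall>xs. set xs \<subseteq> \<phi> ` X \<longrightarrow> (\<exists>p\<in>?P. \<exists>z\<in>Z0. list_prod T xs = p \<otimes>\<^bsub>T\<^esub> z)"
    using T.finite_transversal[OF \<phi>X sub pow] by blast
  \<comment> \<open>The identity is added as the representative from which rewriting starts.\<close>
  define Z where "Z = insert \<one> (pick ` Z0)"
  have Z: "finite Z" "Z \<subseteq> carrier M" "\<one> \<in> Z" using Z0 pick by (auto simp: Z_def)
  show ?thesis
  proof (rule area_bound_from_transversal[OF metab \<phi>.normal_kernel _ _ _ t(1) X(1,2) Z])
    have "\<phi> (x \<otimes> y \<otimes> inv x \<otimes> inv y) = \<one>\<^bsub>T\<^esub>" if "x \<in> carrier M" "y \<in> carrier M" for x y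
      using that T.m_comm[of "\<phi> x" "\<phi> y"] by (simp add: T.m_assoc)
    then show "derived M (carrier M) \<subseteq> ?H"
      unfolding derived_def
      by (intro generate_subgroup_incl \<phi>.subgroup_kernel) (auto simp: kernel_def)
    show "normal_closure M R \<subseteq> ?H"
      using N normal_closure_carrier by (auto simp: kernel_def)
    show "br x y \<in> normal_closure M R" if "x \<in> ?H" "y \<in> ?H" for x y
      using br that by (auto simp: kernel_def)
  next
    fix g assume g: "g \<in> carrier M"
    obtain xs where xs: "set xs \<subseteq> X" "g = list_prod M xs" using X(3)[OF g] by blast
    have "set (map \<phi> xs) \<subseteq> \<phi> ` X" using xs(1) by auto
    then obtain p z where pz: "p \<in> ?P" "z \<in> Z0" "list_prod T (map \<phi> xs) = p \<otimes>\<^bsub>T\<^esub> z"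
      using Z0(3) by blast
    have "\<phi> g = p \<otimes>\<^bsub>T\<^esub> z"
      using \<phi>.hom_list_prod[of xs] xs X(2) pz(3) by auto
    obtain v where v: "set v \<subseteq> {..<2 * k}" "p = list_prod T (map (signed_power T \<sigma>) v)"
      using T.generate_signed_power[OF \<sigma>S(1) ST(2) pz(1)] by blast
    let ?w = "list_prod M (map (signed_power M t) v)"
    have w: "?w \<in> carrier M" "\<phi> ?w = p" using vc v\<phi> v by auto
    have z: "pick z \<in> carrier M" "\<phi> (pick z) = z" "pick z \<in> Z" using pz(2) Z0(2) pick by (auto simp: Z_def)
    have "p \<in> carrier T" "z \<in> carrier T" using \<phi>.hom_closed[OF w(1)] w(2) pz(2) Z0(2) by auto
    then have "\<phi> (g \<otimes> inv (?w \<otimes> pick z)) = \<one>\<^bsub>T\<^esub>"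
      using g w z \<open>\<phi> g = p \<otimes>\<^bsub>T\<^esub> z\<close> by simp
    then have "g \<otimes> inv (?w \<otimes> pick z) \<in> ?H" using g w z by (simp add: kernel_def)
    moreover have "g = g \<otimes> inv (?w \<otimes> pick z) \<otimes> ?w \<otimes> pick z"
      using g w z by (simp add: group_word_simps)
    ultimately show "\<exists>h\<in>?H. \<exists>v. \<exists>z\<in>Z. set v \<subseteq> {..<2 * k} \<and>
        g = h \<otimes> list_prod M (map (signed_power M t) v) \<otimes> z"
      using v(1) z(3) by blast
  next
    fix v i assume v: "set v \<subseteq> {..<2 * k}" and w: "list_prod M (map (signed_power M t) v) \<in> ?H"
      and i: "i < k"
    have "list_prod T (map (signed_power T \<sigma>) v) = \<one>\<^bsub>T\<^esub>"
      using w v\<phi>[OF v] by (simp add: kernel_def)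
    then have 1: "(\<Otimes>\<^bsub>T\<^esub>i\<in>{..<k}. \<sigma> i [^]\<^bsub>T\<^esub> exponent v i) = \<one>\<^bsub>T\<^esub>"
      using T.list_prod_signed_power[OF v \<sigma>T] by simp
    \<comment> \<open>\<open>Z_independent\<close> takes exponents indexed by the elements of
      \<open>S\<close>, so the exponents are transported along the enumeration
      \<open>\<sigma>\<close>.\<close>
    define c where "c s = exponent v (inv_into {..<k} \<sigma> s)" for s
    have c: "c (\<sigma> i) = exponent v i" if "i < k" for i
      using inv_into_f_f[OF \<sigma>S(2)] that by (simp add: c_def)
    have "(\<Otimes>\<^bsub>T\<^esub>s\<in>\<sigma> ` {..<k}. s [^]\<^bsub>T\<^esub> c s) = (\<Otimes>\<^bsub>T\<^esub>i\<in>{..<k}. \<sigma> i [^]\<^bsub>T\<^esub> c (\<sigma> i))"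
      using \<sigma>T by (intro T.finprod_reindex[OF _ \<sigma>S(2)]) auto
    also have "\<dots> = (\<Otimes>\<^bsub>T\<^esub>i\<in>{..<k}. \<sigma> i [^]\<^bsub>T\<^esub> exponent v i)"
      using \<sigma>T c by (intro T.finprod_cong) (auto simp: simp_implies_def)
    finally have "(\<Otimes>\<^bsub>T\<^esub>s\<in>S. s [^]\<^bsub>T\<^esub> c s) = \<one>\<^bsub>T\<^esub>" using 1 \<sigma>S(1) by simp
    then have "\<forall>s\<in>S. c s = 0" using S(1) unfolding Z_independent_def by blast
    then show "exponent v i = 0" using c[OF i] \<sigma>S(1) i by auto
  qed
qed

section \<open>Commutativity of the derived subgroup of a free metabelian group\<close>

lemma derived_FactGroup_second_derived_comm:
  assumes "group F"
    and "x \<in> derived (F Mod second_derived F) (carrier (F Mod second_derived F))"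
    and "y \<in> derived (F Mod second_derived F) (carrier (F Mod second_derived F))"
  shows "x \<otimes>\<^bsub>F Mod second_derived F\<^esub> y = y \<otimes>\<^bsub>F Mod second_derived F\<^esub> x"
proof -
  interpret F: group F by fact
  let ?D = "derived F (carrier F)" and ?N = "second_derived F"
  let ?Q = "F Mod ?N"
  interpret N: normal ?N F by (rule normal_second_derived[OF assms(1)])
  interpret Q: group ?Q by (rule N.factorgroup_is_group)
  interpret q: group_hom F ?Q "\<lambda>a. ?N #>\<^bsub>F\<^esub> a" by unfold_locales (rule N.r_coset_hom_Mod)
  have DF: "?D \<subseteq> carrier F" by (simp add: F.derived_in_carrier)
  \<comment> \<open>Commutators in the quotient are images of commutators, so its derived subgroup
    is covered by that of \<open>F\<close>; commutators of such lifts fall into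
    \<open>?N\<close>.\<close>
  have lift: "\<exists>u\<in>?D. z = ?N #>\<^bsub>F\<^esub> u" if "z \<in> derived ?Q (carrier ?Q)" for z
    using that unfolding derived_def[of ?Q]
  proof (induction rule: generate.induct)
    case one
    have "\<one>\<^bsub>F\<^esub> \<in> ?D" by (simp add: derived_def generate.one)
    then show ?case using q.hom_one by metis
  next
    case (incl z)
    then obtain a b where ab: "a \<in> carrier F" "b \<in> carrier F" and
      z: "z = (?N #>\<^bsub>F\<^esub> a) \<otimes>\<^bsub>?Q\<^esub> (?N #>\<^bsub>F\<^esub> b) \<otimes>\<^bsub>?Q\<^esub> inv\<^bsub>?Q\<^esub> (?N #>\<^bsub>F\<^esub> a) \<otimes>\<^bsub>?Q\<^esub> inv\<^bsub>?Q\<^esub> (?N #>\<^bsub>F\<^esub> b)"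
      by (auto simp: carrier_FactGroup)
    have "z = ?N #>\<^bsub>F\<^esub> F.br a b"
      unfolding z F.br_def using ab by (simp only: q.hom_mult q.hom_inv F.m_closed F.inv_closed)
    then show ?case using F.br_in_derived ab by blast
  next
    case (inv z)
    then obtain a b where ab: "a \<in> carrier F" "b \<in> carrier F" and
      z: "z = (?N #>\<^bsub>F\<^esub> a) \<otimes>\<^bsub>?Q\<^esub> (?N #>\<^bsub>F\<^esub> b) \<otimes>\<^bsub>?Q\<^esub> inv\<^bsub>?Q\<^esub> (?N #>\<^bsub>F\<^esub> a) \<otimes>\<^bsub>?Q\<^esub> inv\<^bsub>?Q\<^esub> (?N #>\<^bsub>F\<^esub> b)"
      by (auto simp: carrier_FactGroup)
    have "z = ?N #>\<^bsub>F\<^esub> F.br a b"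
      unfolding z F.br_def using ab by (simp only: q.hom_mult q.hom_inv F.m_closed F.inv_closed)
    then have "inv\<^bsub>?Q\<^esub> z = ?N #>\<^bsub>F\<^esub> (inv\<^bsub>F\<^esub> (F.br a b))" using ab q.hom_inv by simp
    moreover have "inv\<^bsub>F\<^esub> (F.br a b) \<in> ?D"
      using F.br_in_derived[OF ab] F.generate_m_inv_closed[of "\<Union>a\<in>carrier F. \<Union>b\<in>carrier F. {a \<otimes>\<^bsub>F\<^esub> b \<otimes>\<^bsub>F\<^esub> inv\<^bsub>F\<^esub> a \<otimes>\<^bsub>F\<^esub> inv\<^bsub>F\<^esub> b}"]
      unfolding derived_def by auto
    ultimately show ?case by blast
  next
    case (eng z1 z2)
    then obtain u1 u2 where u: "u1 \<in> ?D" "u2 \<in> ?D" "z1 = ?N #>\<^bsub>F\<^esub> u1" "z2 = ?N #>\<^bsub>F\<^esub> u2" by blast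
    then have "z1 \<otimes>\<^bsub>?Q\<^esub> z2 = ?N #>\<^bsub>F\<^esub> (u1 \<otimes>\<^bsub>F\<^esub> u2)"
      using DF q.hom_mult[of u1 u2] by (simp only: subset_iff)
    moreover have "u1 \<otimes>\<^bsub>F\<^esub> u2 \<in> ?D" using u unfolding derived_def by (intro generate.eng)
    ultimately show ?case by blast
  qed
  obtain u v where uv: "u \<in> ?D" "v \<in> ?D" "x = ?N #>\<^bsub>F\<^esub> u" "y = ?N #>\<^bsub>F\<^esub> v"
    using lift assms(2,3) by metis
  have uvF: "u \<in> carrier F" "v \<in> carrier F" using uv DF by auto
  have "F.br u v \<in> ?N"
    unfolding second_derived_def derived_def[of F ?D] F.br_def
    by (rule generate.incl) (use uv in blast)
  then have "?N #>\<^bsub>F\<^esub> F.br u v = \<one>\<^bsub>?Q\<^esub>"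
    using F.coset_join2[of "F.br u v" ?N] N.subgroup_axioms uvF by simp
  moreover have "u \<otimes>\<^bsub>F\<^esub> v = F.br u v \<otimes>\<^bsub>F\<^esub> (v \<otimes>\<^bsub>F\<^esub> u)"
    using uvF by (simp add: F.br_def F.group_word_simps)
  then have "?N #>\<^bsub>F\<^esub> (u \<otimes>\<^bsub>F\<^esub> v) = (?N #>\<^bsub>F\<^esub> F.br u v) \<otimes>\<^bsub>?Q\<^esub> (?N #>\<^bsub>F\<^esub> (v \<otimes>\<^bsub>F\<^esub> u))"
    using uvF q.hom_mult by simp
  ultimately have "?N #>\<^bsub>F\<^esub> (u \<otimes>\<^bsub>F\<^esub> v) = ?N #>\<^bsub>F\<^esub> (v \<otimes>\<^bsub>F\<^esub> u)"
    using uvF by (simp only: Q.l_one q.hom_closed F.m_closed)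
  then show ?thesis using uv(3,4) q.hom_mult[OF uvF] q.hom_mult[OF uvF(2,1)] by (simp only:)
qed

section \<open>The relative Dehn function\<close>

text \<open>It is enough to bound the area of words, since an element is the product of a word
  realizing its length.\<close>

lemma relative_dehn_le:
  assumes "finite B" "R \<subseteq> carrier (free_metabelian B)"
    and bound: "\<And>xs. set xs \<subseteq> free_metabelian_gen B ` B \<union>
          m_inv (free_metabelian B) ` free_metabelian_gen B ` B \<Longrightarrow> length xs \<le> n \<Longrightarrow>
        list_prod (free_metabelian B) xs \<in> normal_closure (free_metabelian B) R \<Longrightarrow>
        relators.area (free_metabelian B) R l (list_prod (free_metabelian B) xs)"
  shows "relative_dehn B R n \<le> l"
proof -
  let ?M = "free_metabelian B"
  let ?X = "free_metabelian_gen B ` B \<union> m_inv ?M ` free_metabelian_gen B ` B"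
  interpret group ?M by (rule group_free_metabelian)
  interpret relators ?M R by unfold_locales (rule assms(2))
  have le: "relative_area B R w \<le> l"
    if w: "w \<in> normal_closure ?M R" "word_length ?M (free_metabelian_gen B ` B) w \<le> n" for w
  proof -
    have "w \<in> carrier ?M" using w(1) normal_closure_carrier by (rule rev_subsetD)
    then have "\<exists>xs. set xs \<subseteq> ?X \<and> w = list_prod ?M xs" by (rule free_metabelian_word)
    then have "\<exists>m xs. length xs = m \<and> set xs \<subseteq> ?X \<and> w = list_prod ?M xs" by blast
    then have "\<exists>xs. length xs = word_length ?M (free_metabelian_gen B ` B) w \<and>
        set xs \<subseteq> ?X \<and> w = list_prod ?M xs"
      unfolding word_length_def by (rule LeastI_ex)
    then obtain xs where "length xs = word_length ?M (free_metabelian_gen B ` B) w"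
      and xs23: "set xs \<subseteq> ?X" "w = list_prod ?M xs" by blast
    then have xs1: "length xs \<le> n" using w(2) by simp
    note xs = xs1 xs23
    have "area l w" using bound[OF xs(2,1)] w(1) xs(3) by blast
    then obtain ps where ps: "length ps \<le> l" "set ps \<subseteq> carrier ?M \<times> (R \<union> m_inv ?M ` R)"
      "w = list_prod ?M (map (\<lambda>(f, r). inv\<^bsub>?M\<^esub> f \<otimes>\<^bsub>?M\<^esub> r \<otimes>\<^bsub>?M\<^esub> f) ps)"
      using area_list by blast
    have "relative_area B R w \<le> length ps"
      unfolding relative_area_def Let_def by (rule Least_le) (use ps in blast)
    then show ?thesis using ps(1) by linarith
  qed
  show ?thesis
  \<comment> \<open>The least upper bound property needs a nonempty set; the supremum of the empty
    set of naturals is 0.\<close>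
  proof (cases "relative_areas B R n = {}")
    case True
    then show ?thesis by (simp add: relative_dehn_def Sup_nat_def)
  next
    case False
    then show ?thesis
      unfolding relative_dehn_def by (rule cSup_least) (auto simp: relative_areas_def intro: le)
  qed
qed

section \<open>Comparison of growth functions\<close>

lemma preceq_square_of_bound:
  assumes "\<And>n. f n \<le> E * (((n + 1) * C)\<^sup>2)"
  shows "f \<preceq> (\<lambda>n. n ^ 2)"
proof -
  \<comment> \<open>For positive \<open>n\<close> the square of \<open>n + 1\<close> is at most
    \<open>4 * n^2\<close>; this is the factor 4.\<close>
  let ?K = "4 * E * C\<^sup>2 + 1"
  have "f n \<le> ?K * (?K * n)\<^sup>2 + ?K * n + ?K" if "n > 0" for n
  proof -
    have "(n + 1)\<^sup>2 \<le> (2 * n)\<^sup>2" using that by (intro power_mono) auto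
    then have "E * (((n + 1) * C)\<^sup>2) \<le> E * ((2 * n)\<^sup>2 * C\<^sup>2)"
      by (simp only: power_mult_distrib mult_le_mono)
    also have "\<dots> = 4 * E * C\<^sup>2 * n\<^sup>2" by (simp add: power_mult_distrib)
    also have "\<dots> \<le> ?K * (?K * n)\<^sup>2"
      by (intro mult_le_mono power_mono) simp_all
    finally show ?thesis using assms[of n] by linarith
  qed
  then show ?thesis unfolding asymp_preceq_def by (intro exI[of _ ?K]) simp
qed

lemma preceq_exponential_of_bound:
  fixes f :: "nat \<Rightarrow> nat"
  assumes k: "k > 0" and f: "\<And>n D. D = d * (n + 1) \<Longrightarrow>
    f n \<le> E * (((n + 1 + D * D) * C ^ (s * (D + 1) ^ (2 * k)))\<^sup>2 * (D + 1)\<^sup>2)"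
  shows "f \<preceq> (\<lambda>n. 2 ^ (n ^ (2 * k)))"
proof -
  \<comment> \<open>Both \<open>D + 1\<close> and \<open>n + 1\<close> are at most
    \<open>y = ?a * n\<close>. With \<open>y \<le> 2 ^ Y\<close>, the factor
    \<open>4 * y ^ 6\<close> contributes \<open>2 + 6 = 8\<close> to \<open>?b\<close>, and the
    squared power of \<open>C\<close> contributes \<open>2 * s * C\<close>.\<close>
  let ?b = "8 + 2 * s * C" and ?a = "2 * (d + 1)"
  let ?K = "?b * ?a + E"
  have "f n \<le> ?K * 2 ^ ((?K * n) ^ (2 * k)) + ?K * n + ?K" if n: "n > 0" for n
  proof -
    define D where "D = d * (n + 1)"
    define y where "y = ?a * n"
    define Y where "Y = y ^ (2 * k)"
    have "D + 1 \<le> (d + 1) * (n + 1)" by (simp add: D_def algebra_simps)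
    also have "\<dots> \<le> (d + 1) * (2 * n)" using n by (intro mult_le_mono) auto
    also have "\<dots> = y" by (simp add: y_def algebra_simps)
    finally have Dy: "D + 1 \<le> y" .
    have "1 * (n + 1) \<le> (d + 1) * (2 * n)" using n by (intro mult_le_mono) auto
    then have ny: "n + 1 \<le> y" by (simp add: y_def algebra_simps)
    have yY: "y \<le> Y" unfolding Y_def using k ny by (intro self_le_power) auto
    have y2: "y \<le> 2 ^ Y" using yY less_exp[of Y] by linarith
    have "n + 1 + D * D \<le> y * y + y * y"
      using ny Dy mult_le_mono[of 1 y "n + 1" y] by (intro add_mono mult_le_mono) auto
    also have "\<dots> = 2 * y\<^sup>2" by (simp add: power2_eq_square)
    finally have 1: "n + 1 + D * D \<le> 2 * y\<^sup>2" .
    have C2: "C ^ (s * (D + 1) ^ (2 * k)) \<le> 2 ^ (s * C * Y)"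
    proof -
      have "C ^ (s * (D + 1) ^ (2 * k)) \<le> (2 ^ C) ^ (s * (D + 1) ^ (2 * k))"
        using less_exp[of C] by (intro power_mono) auto
      also have "\<dots> = 2 ^ (C * (s * (D + 1) ^ (2 * k)))" by (simp only: power_mult)
      also have "\<dots> \<le> 2 ^ (C * (s * Y))"
        unfolding Y_def using Dy by (intro power_increasing mult_le_mono power_mono) auto
      finally show ?thesis by (simp only: ac_simps)
    qed
    have "f n \<le> E * (((n + 1 + D * D) * C ^ (s * (D + 1) ^ (2 * k)))\<^sup>2 * (D + 1)\<^sup>2)"
      by (rule f) (simp add: D_def)
    also have "\<dots> \<le> E * ((2 * y\<^sup>2 * 2 ^ (s * C * Y))\<^sup>2 * y\<^sup>2)"
      using 1 C2 Dy by (intro mult_le_mono power_mono order_refl) auto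
    also have "\<dots> = E * (4 * y ^ 6 * 2 ^ (2 * s * C * Y))"
      by (simp add: power_mult_distrib power_mult[symmetric] power_add[symmetric] algebra_simps)
    also have "\<dots> \<le> E * (2 ^ (2 * Y) * (2 ^ Y) ^ 6 * 2 ^ (2 * s * C * Y))"
    proof -
      have "Y \<ge> 1" using yY ny by linarith
      then have "(2::nat) ^ 2 \<le> 2 ^ (2 * Y)" by (intro power_increasing) auto
      then show ?thesis using y2 by (intro mult_le_mono power_mono order_refl) auto
    qed
    also have "\<dots> = E * 2 ^ (?b * Y)"
      by (simp add: power_mult[symmetric] power_add[symmetric] algebra_simps)
    also have "\<dots> \<le> ?K * 2 ^ ((?K * n) ^ (2 * k))"
    proof -
      \<comment> \<open>As the exponent \<open>2 * k\<close> is positive, the constant moves inside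
        the power and is absorbed into the argument \<open>?K * n\<close>.\<close>
      have "?b * Y \<le> ?b ^ (2 * k) * Y"
        using k by (intro mult_le_mono1 self_le_power) auto
      also have "\<dots> = (?b * y) ^ (2 * k)" by (simp only: Y_def power_mult_distrib)
      also have "\<dots> \<le> (?K * n) ^ (2 * k)"
        unfolding y_def mult.assoc[symmetric] by (intro power_mono mult_le_mono1) auto
      finally show ?thesis by (intro mult_le_mono power_increasing) auto
    qed
    finally show ?thesis by linarith
  qed
  then show ?thesis unfolding asymp_preceq_def by (intro exI[of _ ?K]) simp
qed

text \<open>The map is the composite of \<open>M\<close>, \<open>M Mod N\<close>, \<open>G\<close>,
  \<open>G Mod A\<close> and \<open>T\<close>. Its kernel is sent into the abelian subgroup
  \<open>A\<close>, so commutators of kernel elements are trivial in \<open>G\<close> and lie in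
  \<open>N\<close>.\<close>

lemma abelian_quotient_morphism:
  fixes G :: "('a, 'b) monoid_scheme" and M :: "('m, 'n) monoid_scheme" and T :: "('c, 'd) monoid_scheme"
  assumes "group G" "group M" "group T" "N \<lhd> M" "G \<cong> M Mod N"
    and A: "A \<lhd> G" "comm_group (G\<lparr>carrier := A\<rparr>)" "G Mod A \<cong> T"
  obtains \<phi> where "\<phi> \<in> hom M T" "\<phi> ` carrier M = carrier T"
    "\<And>x. x \<in> N \<Longrightarrow> \<phi> x = \<one>\<^bsub>T\<^esub>"
    "\<And>x y. x \<in> carrier M \<Longrightarrow> y \<in> carrier M \<Longrightarrow> \<phi> x = \<one>\<^bsub>T\<^esub> \<Longrightarrow> \<phi> y = \<one>\<^bsub>T\<^esub> \<Longrightarrow>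
      group.br M x y \<in> N"
proof -
  interpret G: group G by fact
  interpret M: group M by fact
  interpret T: group T by fact
  interpret N: normal N M by fact
  interpret A: normal A G by fact
  interpret MN: group "M Mod N" by (rule N.factorgroup_is_group)
  interpret GA: group "G Mod A" by (rule A.factorgroup_is_group)
  obtain g0 where g0: "g0 \<in> iso G (M Mod N)" using assms(5) by (auto simp: is_iso_def)
  define g where "g = inv_into (carrier G) g0"
  have g: "g \<in> iso (M Mod N) G" unfolding g_def by (rule G.iso_set_sym[OF g0])
  obtain t where t: "t \<in> iso (G Mod A) T" using A(3) by (auto simp: is_iso_def)
  define \<psi> where "\<psi> = g \<circ> (\<lambda>x. N #>\<^bsub>M\<^esub> x)"
  have \<psi>: "\<psi> \<in> hom M G"
    unfolding \<psi>_def by (rule hom_compose[OF N.r_coset_hom_Mod]) (use g in \<open>simp add: iso_def\<close>)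
  define \<phi> where "\<phi> = t \<circ> ((\<lambda>x. A #>\<^bsub>G\<^esub> x) \<circ> \<psi>)"
  have \<phi>: "\<phi> \<in> hom M T"
    unfolding \<phi>_def
    by (rule hom_compose[OF hom_compose[OF \<psi> A.r_coset_hom_Mod]]) (use t in \<open>simp add: iso_def\<close>)
  interpret \<psi>: group_hom M G \<psi> by unfold_locales (rule \<psi>)
  interpret \<phi>: group_hom M T \<phi> by unfold_locales (rule \<phi>)
  interpret g: group_hom "M Mod N" G g by unfold_locales (use g in \<open>simp add: iso_def\<close>)
  interpret t: group_hom "G Mod A" T t by unfold_locales (use t in \<open>simp add: iso_def\<close>)
  have gb: "inj_on g (carrier (M Mod N))" "g ` carrier (M Mod N) = carrier G"
    using g by (auto simp: iso_def bij_betw_def)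
  have tb: "inj_on t (carrier (G Mod A))" "t ` carrier (G Mod A) = carrier T"
    using t by (auto simp: iso_def bij_betw_def)
  have cM: "N #>\<^bsub>M\<^esub> x \<in> carrier (M Mod N)" if "x \<in> carrier M" for x
    using that by (auto simp: carrier_FactGroup)
  have cG: "A #>\<^bsub>G\<^esub> x \<in> carrier (G Mod A)" if "x \<in> carrier G" for x
    using that by (auto simp: carrier_FactGroup)
  have \<psi>ker: "x \<in> N" if "x \<in> carrier M" "\<psi> x = \<one>\<^bsub>G\<^esub>" for x
  proof -
    have "g (N #>\<^bsub>M\<^esub> x) = g \<one>\<^bsub>M Mod N\<^esub>" using that(2) g.hom_one unfolding \<psi>_def comp_def by (simp only:)
    then have "N #>\<^bsub>M\<^esub> x = \<one>\<^bsub>M Mod N\<^esub>" using inj_onD[OF gb(1)] cM[OF that(1)] MN.one_closed by blast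
    then show ?thesis using M.coset_join1[OF _ that(1) N.subgroup_axioms] by simp
  qed
  have \<phi>ker: "\<psi> x \<in> A" if "x \<in> carrier M" "\<phi> x = \<one>\<^bsub>T\<^esub>" for x
  proof -
    have "t (A #>\<^bsub>G\<^esub> \<psi> x) = t \<one>\<^bsub>G Mod A\<^esub>" using that(2) t.hom_one unfolding \<phi>_def comp_def by (simp only:)
    then have "A #>\<^bsub>G\<^esub> \<psi> x = \<one>\<^bsub>G Mod A\<^esub>"
      using inj_onD[OF tb(1)] cG[OF \<psi>.hom_closed[OF that(1)]] GA.one_closed by blast
    then show ?thesis using G.coset_join1[OF _ \<psi>.hom_closed[OF that(1)] A.subgroup_axioms] by simp
  qed
  show ?thesis
  proof (rule that[OF \<phi>])
    have "(\<lambda>x. N #>\<^bsub>M\<^esub> x) ` carrier M = carrier (M Mod N)"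
      "(\<lambda>x. A #>\<^bsub>G\<^esub> x) ` carrier G = carrier (G Mod A)" by (auto simp: carrier_FactGroup)
    then show "\<phi> ` carrier M = carrier T"
      unfolding \<phi>_def \<psi>_def image_comp[symmetric] using gb(2) tb(2) by simp
  next
    fix x assume x: "x \<in> N"
    then have xM: "x \<in> carrier M" using N.subset by blast
    have "N #>\<^bsub>M\<^esub> x = \<one>\<^bsub>M Mod N\<^esub>" using M.coset_join2[OF xM N.subgroup_axioms x] by simp
    then have "\<psi> x = \<one>\<^bsub>G\<^esub>" using g.hom_one unfolding \<psi>_def comp_def by (simp only:)
    then have "A #>\<^bsub>G\<^esub> \<psi> x = \<one>\<^bsub>G Mod A\<^esub>" 
      using G.coset_join2[OF _ A.subgroup_axioms A.one_closed] by simp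
    then show "\<phi> x = \<one>\<^bsub>T\<^esub>" using t.hom_one unfolding \<phi>_def comp_def by (simp only:)
  next
    fix x y assume xy: "x \<in> carrier M" "y \<in> carrier M" and "\<phi> x = \<one>\<^bsub>T\<^esub>" "\<phi> y = \<one>\<^bsub>T\<^esub>"
    then have "\<psi> x \<in> A" "\<psi> y \<in> A" using \<phi>ker by auto
    then have "\<psi> x \<otimes>\<^bsub>G\<^esub> \<psi> y = \<psi> y \<otimes>\<^bsub>G\<^esub> \<psi> x"
      using comm_groupE(4)[OF A(2), of "\<psi> x" "\<psi> y"] by simp
    then have "\<psi> (M.br x y) = \<one>\<^bsub>G\<^esub>"
      using xy by (simp add: M.br_def G.m_assoc)
    then show "M.br x y \<in> N" using \<psi>ker xy by simp
  qed
qed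

theorem theorem1p4:
  fixes G :: "('a, 'b) monoid_scheme"
    and B :: "'x set" and R :: "'x letter list set set"
    and k :: nat
  assumes "group G" and "metabelian G" and "finitely_generated_group G"
    and k_attained: "enat k \<in> abelian_quotient_ranks G"
    and k_minimal: "\<forall>r \<in> abelian_quotient_ranks G. enat k \<le> r"
    and "finite_relative_presentation G B R"
  shows "(k = 0 \<longrightarrow> relative_dehn B R \<preceq> (\<lambda>n. n ^ 2)) \<and>
         (k > 0 \<longrightarrow> relative_dehn B R \<preceq> (\<lambda>n. 2 ^ (n ^ (2 * k))))"
proof -
  let ?M = "free_metabelian B"
  let ?N = "normal_closure ?M R"
  let ?X = "free_metabelian_gen B ` B \<union> m_inv ?M ` free_metabelian_gen B ` B"
  have B: "finite B" and R: "R \<subseteq> carrier ?M" and iso: "G \<cong> ?M Mod ?N"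
    using assms(6) by (auto simp: finite_relative_presentation_def)
  interpret M: group ?M by (rule group_free_metabelian)
  interpret M: relators ?M R by unfold_locales (rule R)
  obtain T :: "'a set monoid" and A where T: "comm_group T" "torsion_free_rank T = enat k"
    and A: "A \<lhd> G" "comm_group (G\<lparr>carrier := A\<rparr>)" "G Mod A \<cong> T"
    using k_attained unfolding abelian_quotient_ranks_def by auto
  have "subgroup ?N ?M"
    by (rule M.subgroupI)
      (use M.normal_closure_carrier M.normal_closure_one M.normal_closure_mult M.normal_closure_inv
        in auto)
  then have N: "?N \<lhd> ?M"
    using M.normal_closure_conj by (simp add: M.normal_inv_iff)
  obtain \<phi> where \<phi>: "\<phi> \<in> hom ?M T" "\<phi> ` carrier ?M = carrier T"
    "\<And>x. x \<in> ?N \<Longrightarrow> \<phi> x = \<one>\<^bsub>T\<^esub>"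
    "\<And>x y. x \<in> carrier ?M \<Longrightarrow> y \<in> carrier ?M \<Longrightarrow> \<phi> x = \<one>\<^bsub>T\<^esub> \<Longrightarrow> \<phi> y = \<one>\<^bsub>T\<^esub> \<Longrightarrow>
      M.br x y \<in> ?N"
    using abelian_quotient_morphism[OF assms(1) M.group_axioms comm_group.axioms(2)[OF T(1)] N iso A]
    by blast
  have gen: "free_metabelian_gen B x \<in> carrier ?M" if "x \<in> B" for x
    using that by (auto simp: free_metabelian_gen_def free_metabelian_def carrier_FactGroup free_group_simps)
  then have X: "finite ?X" "?X \<subseteq> carrier ?M" using B by auto
  have metab: "x \<otimes>\<^bsub>?M\<^esub> y = y \<otimes>\<^bsub>?M\<^esub> x"
    if "x \<in> derived ?M (carrier ?M)" "y \<in> derived ?M (carrier ?M)" for x y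
    using derived_FactGroup_second_derived_comm[OF group_free_group] that
    unfolding free_metabelian_def by blast
  obtain d s E C where d: "k = 0 \<longrightarrow> d = 0" and area: "\<forall>n D xs. set xs \<subseteq> ?X \<longrightarrow>
      length xs \<le> n \<longrightarrow> D = d * (n + 1) \<longrightarrow> list_prod ?M xs \<in> ?N \<longrightarrow>
      M.area (E * (((n + 1 + D * D) * C ^ (s * (D + 1) ^ (2 * k)))\<^sup>2 * (D + 1)\<^sup>2)) (list_prod ?M xs)"
    using M.area_bound_from_quotient[OF metab T \<phi> X free_metabelian_word] by blast
  have dehn: "relative_dehn B R n \<le> E * (((n + 1 + D * D) * C ^ (s * (D + 1) ^ (2 * k)))\<^sup>2 * (D + 1)\<^sup>2)"
    if "D = d * (n + 1)" for n D
    using relative_dehn_le[OF B R] area that by blast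
  show ?thesis
  proof (intro conjI impI)
    \<comment> \<open>Here \<open>D = 0\<close> and \<open>(D + 1) ^ (2 * k) = 1\<close>, so the
      exponential factor is the constant \<open>C ^ s\<close>.\<close>
    assume "k = 0"
    then show "relative_dehn B R \<preceq> (\<lambda>n. n ^ 2)"
      using dehn[of 0] d by (intro preceq_square_of_bound[of _ E "C ^ s"]) simp
  next
    assume "k > 0"
    then show "relative_dehn B R \<preceq> (\<lambda>n. 2 ^ (n ^ (2 * k)))"
      using dehn by (rule preceq_exponential_of_bound)
  qed
qed

end
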